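(* Let $T>0$, $A\ge 0$, and let $b:\mathbb{R}\times(-\infty,T]\to\mathbb{R}$ be a continuous function $b(y,t)$, differentiable in $y$ with $\partial b/\partial y$ continuous in $(y,t)$, satisfying $\sup\{|\partial b(y,t)/\partial y| : y\in\mathbb{R},\ t\le T\}\le A$, and suppose $b(y,t)$ is concave in $y\in\mathbb{R}$ for every $t\le T$. Let $\varepsilon>0$ and let $q_\varepsilon$ be the function defined in the context. Then for every $t<T$ the function $(x,y)\mapsto q_\varepsilon(x,y,t)$ is convex on $\mathbb{R}^2$.
   Context: Let $Y_\varepsilon$ be the solution of $dY_\varepsilon(s)=b(Y_\varepsilon(s),s)\,ds+\sqrt{\varepsilon}\,dW(s)$, $t\le s\le T$, with $W$ Brownian motion. For $x,y\in\mathbb{R}$, $t<T$ put $u_\varepsilon(x,y,t)=P(Y_\varepsilon(T)>x \mid Y_\varepsilon(t)=y)$ (equivalently, $u_\varepsilon$ is the bounded solution of $\partial_t u_\varepsilon+b(y,t)\partial_y u_\varepsilon+\frac{\varepsilon}{2}\partial_y^2u_\varepsilon=0$, $t<T$, with terminal limit $0$ for $y<x$ and $1$ for $y>x$), and define $q_\varepsilon$ by $u_\varepsilon(x,y,t)=\exp[-q_\varepsilon(x,y,t)/\varepsilon]$. *)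

theory Defs
  imports "HOL-Probability.Probability"
begin

text \<open>
  Brownian motion on a time set \<open>I\<close>. No value at a fixed time is prescribed: only increments enter
  an equation driven by \<open>dW\<close>, and \<open>I\<close> may be unbounded below.
\<close>

definition brownian_motion :: "'w measure \<Rightarrow> real set \<Rightarrow> (real \<Rightarrow> 'w \<Rightarrow> real) \<Rightarrow> bool" where
  "brownian_motion M I W \<longleftrightarrow>
     prob_space M \<and>
     (\<forall>s\<in>I. W s \<in> borel_measurable M) \<and>
     (AE \<omega> in M. continuous_on I (\<lambda>s. W s \<omega>)) \<and>
     (\<forall>r\<in>I. \<forall>s\<in>I. r < s \<longrightarrow>
        distributed M lborel (\<lambda>\<omega>. W s \<omega> - W r \<omega>) (normal_density 0 (sqrt (s - r)))) \<and>
     (\<forall>(n::nat) \<tau>. (\<forall>i\<le>n. \<tau> i \<in> I) \<and> (\<forall>i<n. \<tau> i < \<tau> (Suc i)) \<longrightarrow>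
        prob_space.indep_vars M (\<lambda>_. borel) (\<lambda>i \<omega>. W (\<tau> (Suc i)) \<omega> - W (\<tau> i) \<omega>) {..<n})"

text \<open>
  \<open>Y\<close> solves \<open>dY(s) = b(Y(s),s) ds + sqrt \<epsilon> dW(s)\<close> on \<open>[t,T]\<close> with \<open>Y(t) = y\<close>. Since the noise is
  additive, the stochastic integral is just \<open>sqrt \<epsilon> * (W(s) - W(t))\<close> and the integrated equation
  makes sense path by path. Adaptedness of \<open>Y\<close> is not demanded: for Lipschitz \<open>b\<close> the paths of \<open>Y\<close>
  on \<open>[t,s]\<close> are almost surely determined by those of \<open>W\<close> on \<open>[t,s]\<close>.
\<close>

definition sde_solution ::
  "'w measure \<Rightarrow> (real \<Rightarrow> 'w \<Rightarrow> real) \<Rightarrow> (real \<Rightarrow> real \<Rightarrow> real) \<Rightarrow> real \<Rightarrow>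
   real \<Rightarrow> real \<Rightarrow> real \<Rightarrow> (real \<Rightarrow> 'w \<Rightarrow> real) \<Rightarrow> bool" where
  "sde_solution M W b \<epsilon> T t y Y \<longleftrightarrow>
     (\<forall>s\<in>{t..T}. Y s \<in> borel_measurable M) \<and>
     (AE \<omega> in M. continuous_on {t..T} (\<lambda>s. Y s \<omega>) \<and>
        (\<forall>s\<in>{t..T}. Y s \<omega> = y + integral {t..s} (\<lambda>r. b (Y r \<omega>) r)
                              + sqrt \<epsilon> * (W s \<omega> - W t \<omega>)))"

text \<open>
  In the next two definitions \<open>Y t y\<close> is the solution started from \<open>y\<close> at time \<open>t\<close>, so conditioning
  on \<open>Y(t) = y\<close> amounts to evaluating the probability for \<open>Y t y\<close>.
\<close>

definition tail_prob ::
  "'w measure \<Rightarrow> (real \<Rightarrow> real \<Rightarrow> real \<Rightarrow> 'w \<Rightarrow> real) \<Rightarrow> real \<Rightarrow> real \<Rightarrow> real \<Rightarrow> real \<Rightarrow> real" where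
  "tail_prob M Y T x y t = measure M {\<omega> \<in> space M. Y t y T \<omega> > x}"

text \<open>
  The solution \<open>q\<close> of \<open>tail_prob M Y T x y t = exp (- q / \<epsilon>)\<close>. The tail probability is positive
  whenever \<open>\<epsilon> > 0\<close> and \<open>t < T\<close>, so the convention \<open>ln 0 = 0\<close> plays no role.
\<close>

definition q_fun ::
  "real \<Rightarrow> 'w measure \<Rightarrow> (real \<Rightarrow> real \<Rightarrow> real \<Rightarrow> 'w \<Rightarrow> real) \<Rightarrow> real \<Rightarrow> real \<Rightarrow> real \<Rightarrow> real \<Rightarrow> real" where
  "q_fun \<epsilon> M Y T x y t = - \<epsilon> * ln (tail_prob M Y T x y t)"

end

theory Submission
  imports Defs
begin

text \<open>
  Writing u(x, y) for the probability that the solution started from y at time t exceeds x at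
  time T, the claim is that u is positive and log-concave in (x, y).

  The reason is that the end point of a path of the equation is a concave function of the starting
  point and the driving noise when b is concave, while Gaussian noise has a log-concave density;
  marginals of log-concave functions are log-concave by the Prekopa-Leindler inequality. To stay
  with one-dimensional integrals, the equation is replaced by its Euler scheme with step h. Once
  h A \<le> 1 the map y \<mapsto> y + h b(y, s) is concave and nondecreasing. Then one backward step
  of the scheme, the average over one Gaussian increment, preserves functions that are
  nondecreasing in y and log-concave in (x, y) (\<open>log_concave_noise_average\<close>), starting from
  the indicator of y > x. So the tail probabilities of the scheme are log-concave
  (\<open>log_concave_chain_tail\<close>).

  The noise being additive, the scheme driven by the increments of W converges to the solution
  path by path (\<open>euler_converges\<close>), and log-concavity passes to the limit. Mass that
  might accumulate at a threshold is dealt with by shifting the thresholds (\<open>tail_log_concave_closed\<close>,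
  \<open>tail_log_concave\<close>).

  Positivity of u, without which the logarithm says nothing, comes from a Cameron-Martin argument
  carried out on the scheme (\<open>chain_tail_shifted_drift\<close>). A bounded additional drift steers the
  scheme above x with probability at least 1/2, and removing that drift costs only a
  factor independent of the step size (\<open>euler_tail_bounded_below\<close>).
\<close>

section \<open>One-dimensional Brunn-Minkowski and Prekopa-Leindler inequalities\<close>

lemma emeasure_lborel_affine_image:
  fixes c t :: real
  assumes "A \<in> sets borel" "0 < c"
  shows "emeasure lborel {y. (y - t) / c \<in> A} = ennreal c * emeasure lborel A"
proof -
  have meas: "{y. (y - t) / c \<in> A} \<in> sets borel"
    using measurable_sets[of "\<lambda>y. (y - t) / c" borel borel A] assms by (simp add: vimage_def)
  have "emeasure lborel {y. (y - t) / c \<in> A}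
      = emeasure (density (distr lborel borel (\<lambda>x. t + c * x)) (\<lambda>_. ennreal \<bar>c\<bar>)) {y. (y - t) / c \<in> A}"
    using lborel_real_affine[of c t] assms by simp
  also have "\<dots> = ennreal c * emeasure lborel ((\<lambda>x. t + c * x) -` {y. (y - t) / c \<in> A})"
    using meas assms by (simp add: emeasure_density_const emeasure_distr)
  also have "(\<lambda>x. t + c * x) -` {y. (y - t) / c \<in> A} = A"
    using assms by auto
  finally show ?thesis .
qed

text \<open>
  Let a be almost the supremum of A and b almost the infimum of B. Then C contains the two scaled
  translates (1 - l) A + l b and (1 - l) a + l B. The first lies essentially to the left of the
  second: their overlap sits in an interval of length at most e. So their measures add up inside C
  up to an error e.
\<close>

lemma brunn_minkowski_bounded:
  fixes A B C :: "real set"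
  assumes [measurable]: "A \<in> sets borel" "B \<in> sets borel" "C \<in> sets borel"
    and "A \<noteq> {}" "B \<noteq> {}" "bdd_above A" "bdd_below B" and l: "0 < l" "l < 1"
    and C: "\<And>a b. a \<in> A \<Longrightarrow> b \<in> B \<Longrightarrow> (1 - l) * a + l * b \<in> C"
  shows "ennreal (1 - l) * emeasure lborel A + ennreal l * emeasure lborel B \<le> emeasure lborel C"
proof (rule ennreal_le_epsilon)
  fix e :: real assume "0 < e"
  obtain a where a: "a \<in> A" "Sup A - e < a"
    using less_cSup_iff[of A "Sup A - e"] assms \<open>0 < e\<close> by auto
  obtain b where b: "b \<in> B" "b < Inf B + e"
    using cInf_less_iff[of B "Inf B + e"] assms \<open>0 < e\<close> by auto
  define A' where "A' = {y. (y - l * b) / (1 - l) \<in> A}"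
  define B' where "B' = {y. (y - (1 - l) * a) / l \<in> B}"
  have [measurable]: "A' \<in> sets borel" "B' \<in> sets borel"
    using measurable_sets[of "\<lambda>y. (y - l * b) / (1 - l)" borel borel A]
      measurable_sets[of "\<lambda>y. (y - (1 - l) * a) / l" borel borel B]
    by (simp_all add: A'_def B'_def vimage_def)
  have "A' \<union> B' \<subseteq> C"
  proof
    fix y assume "y \<in> A' \<union> B'"
    then show "y \<in> C"
      using C[of "(y - l * b) / (1 - l)" b] C[of a "(y - (1 - l) * a) / l"] a b l
      by (auto simp: A'_def B'_def)
  qed
  have overlap: "A' \<inter> B' \<subseteq> {(1 - l) * a + l * Inf B .. (1 - l) * Sup A + l * b}"
  proof
    fix y assume y: "y \<in> A' \<inter> B'"
    have "(y - l * b) / (1 - l) \<le> Sup A" "Inf B \<le> (y - (1 - l) * a) / l"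
      using y assms by (auto simp: A'_def B'_def intro: cSup_upper cInf_lower)
    then show "y \<in> {(1 - l) * a + l * Inf B .. (1 - l) * Sup A + l * b}"
      using l by (auto simp: field_simps)
  qed
  have "(1 - l) * Sup A + l * b - ((1 - l) * a + l * Inf B)
      = (1 - l) * (Sup A - a) + l * (b - Inf B)" by (simp add: algebra_simps)
  also have "\<dots> \<le> (1 - l) * e + l * e"
    using a b l by (intro add_mono mult_left_mono) auto
  finally have len: "(1 - l) * Sup A + l * b - ((1 - l) * a + l * Inf B) \<le> e" 
    by (simp add: algebra_simps)
  have "emeasure lborel (A' \<inter> B') \<le> emeasure lborel {(1 - l) * a + l * Inf B .. (1 - l) * Sup A + l * b}"
    using overlap by (intro emeasure_mono) auto
  also have "\<dots> \<le> ennreal e"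
    using len \<open>0 < e\<close> by (auto simp: emeasure_lborel_Icc_eq intro: ennreal_leI)
  finally have ov: "emeasure lborel (A' \<inter> B') \<le> ennreal e" .
  have "ennreal (1 - l) * emeasure lborel A + ennreal l * emeasure lborel B
      = emeasure lborel A' + emeasure lborel B'"
    unfolding A'_def B'_def using l by (simp add: emeasure_lborel_affine_image)
  also have "\<dots> = emeasure lborel (A' \<union> B') + emeasure lborel (A' \<inter> B')"
    by (rule emeasure_Un_Int) simp_all
  also have "\<dots> \<le> emeasure lborel C + ennreal e"
    using \<open>A' \<union> B' \<subseteq> C\<close> ov by (intro add_mono emeasure_mono) auto
  finally show "ennreal (1 - l) * emeasure lborel A + ennreal l * emeasure lborel B
      \<le> emeasure lborel C + ennreal e" .
qed

text \<open>
  Exhausting A and B by their intersections with [-n, n] reduces this to bounded sets.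
\<close>

lemma brunn_minkowski_real:
  fixes A B C :: "real set"
  assumes [measurable]: "A \<in> sets borel" "B \<in> sets borel" "C \<in> sets borel"
    and ne: "A \<noteq> {}" "B \<noteq> {}" and l: "0 < l" "l < 1"
    and C: "\<And>a b. a \<in> A \<Longrightarrow> b \<in> B \<Longrightarrow> (1 - l) * a + l * b \<in> C"
  shows "ennreal (1 - l) * emeasure lborel A + ennreal l * emeasure lborel B \<le> emeasure lborel C"
proof -
  have lim: "(\<lambda>n. emeasure lborel (S \<inter> {-real n..real n})) \<longlonglongrightarrow> emeasure lborel S"
    if [measurable]: "S \<in> sets borel" for S :: "real set"
  proof -
    have "(\<Union>n. {-real n..real n}) = UNIV"
    proof (intro equalityI subsetI)
      fix x :: real
      obtain n where "\<bar>x\<bar> \<le> real n" using real_arch_simple by blast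
      then have "x \<in> {-real n..real n}" by (auto simp: abs_le_iff)
      then show "x \<in> (\<Union>n. {-real n..real n})" by blast
    qed simp
    then have "(\<Union>n. S \<inter> {-real n..real n}) = S" by blast
    moreover have "(\<lambda>n. emeasure lborel (S \<inter> {-real n..real n}))
        \<longlonglongrightarrow> emeasure lborel (\<Union>n. S \<inter> {-real n..real n})"
      by (rule Lim_emeasure_incseq) (auto simp: incseq_def)
    ultimately show ?thesis by simp
  qed
  obtain a b where ab: "a \<in> A" "b \<in> B" using ne by blast
  obtain n0 where n0: "max \<bar>a\<bar> \<bar>b\<bar> \<le> real n0" using real_arch_simple by blast
  have "ennreal (1 - l) * emeasure lborel (A \<inter> {-real n..real n})
      + ennreal l * emeasure lborel (B \<inter> {-real n..real n}) \<le> emeasure lborel C" if "n \<ge> n0" for n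
  proof (rule brunn_minkowski_bounded)
    have "max \<bar>a\<bar> \<bar>b\<bar> \<le> real n" using n0 that by linarith
    then show "A \<inter> {-real n..real n} \<noteq> {}" "B \<inter> {-real n..real n} \<noteq> {}"
      using ab by (auto simp: abs_le_iff disjoint_iff)
  qed (use l C in auto)
  moreover have "(\<lambda>n. ennreal (1 - l) * emeasure lborel (A \<inter> {-real n..real n})
      + ennreal l * emeasure lborel (B \<inter> {-real n..real n})) \<longlonglongrightarrow>
      ennreal (1 - l) * emeasure lborel A + ennreal l * emeasure lborel B"
    by (intro tendsto_add ennreal_tendsto_cmult lim) auto
  ultimately show ?thesis
    by (intro LIMSEQ_le_const2) auto
qed

lemma nn_integral_layer_cake:
  fixes f :: "real \<Rightarrow> real"
  assumes [measurable]: "f \<in> borel_measurable borel"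
  shows "(\<integral>\<^sup>+x. ennreal (f x) \<partial>lborel)
    = (\<integral>\<^sup>+s. indicator {0<..} s * emeasure lborel {x. s < f x} \<partial>lborel)"
proof -
  have "(\<integral>\<^sup>+x. ennreal (f x) \<partial>lborel)
      = (\<integral>\<^sup>+x. (\<integral>\<^sup>+s. indicator {p. 0 < snd p \<and> snd p < f (fst p)} (x, s) \<partial>lborel) \<partial>lborel)"
  proof (rule nn_integral_cong)
    fix x
    have "(\<integral>\<^sup>+s. indicator {p. 0 < snd p \<and> snd p < f (fst p)} (x, s) \<partial>lborel)
        = (\<integral>\<^sup>+s. indicator {0<..<f x} s \<partial>lborel)"
      by (rule nn_integral_cong) (auto simp: indicator_def)
    also have "\<dots> = ennreal (f x)"
      by (cases "0 \<le> f x") (auto simp: ennreal_neg)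
    finally show "ennreal (f x) = (\<integral>\<^sup>+s. indicator {p. 0 < snd p \<and> snd p < f (fst p)} (x, s) \<partial>lborel)" ..
  qed
  also have "\<dots> = (\<integral>\<^sup>+s. (\<integral>\<^sup>+x. indicator {p. 0 < snd p \<and> snd p < f (fst p)} (x, s) \<partial>lborel) \<partial>lborel)"
    by (rule lborel_pair.Fubini'[symmetric]) measurable
  also have "\<dots> = (\<integral>\<^sup>+s. indicator {0<..} s * emeasure lborel {x. s < f x} \<partial>lborel)"
  proof (rule nn_integral_cong)
    fix s :: real
    have "(\<integral>\<^sup>+x. indicator {p. 0 < snd p \<and> snd p < f (fst p)} (x, s) \<partial>lborel)
        = (\<integral>\<^sup>+x. indicator {0<..} s * indicator {x. s < f x} x \<partial>lborel)"
      by (rule nn_integral_cong) (auto simp: indicator_def)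
    also have "\<dots> = indicator {0<..} s * emeasure lborel {x. s < f x}"
      by (subst nn_integral_cmult_indicator) auto
    finally show "(\<integral>\<^sup>+x. indicator {p. 0 < snd p \<and> snd p < f (fst p)} (x, s) \<partial>lborel)
        = indicator {0<..} s * emeasure lborel {x. s < f x}" .
  qed
  finally show ?thesis .
qed

text \<open>
  When both suprema are 1, the levels s below 1 are exactly those on which the superlevel sets of f
  and g are nonempty, so the Brunn-Minkowski inequality applies to all of them and the layer cake
  formula integrates it. The result is stronger than the multiplicative inequality: the geometric
  mean of the integrals is replaced by the arithmetic one.
\<close>

lemma prekopa_leindler_sup_one:
  fixes f g h :: "real \<Rightarrow> real"
  assumes l: "0 < l" "l < 1"
    and int: "integrable lborel f" "integrable lborel g" "integrable lborel h"
    and nn: "\<And>u. 0 \<le> f u" "\<And>u. 0 \<le> g u" "\<And>u. 0 \<le> h u"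
    and bd: "\<And>u. f u \<le> 1" "\<And>u. g u \<le> 1"
    and attained: "\<And>s. s < 1 \<Longrightarrow> \<exists>u. s < f u" "\<And>s. s < 1 \<Longrightarrow> \<exists>u. s < g u"
    and h: "\<And>u v. f u powr (1 - l) * g v powr l \<le> h ((1 - l) * u + l * v)"
  shows "(1 - l) * (\<integral>u. f u \<partial>lborel) + l * (\<integral>u. g u \<partial>lborel) \<le> (\<integral>u. h u \<partial>lborel)"
proof -
  have f_meas [measurable]: "f \<in> borel_measurable borel"
    and g_meas [measurable]: "g \<in> borel_measurable borel"
    and h_meas [measurable]: "h \<in> borel_measurable borel"
    using int[THEN borel_measurable_integrable] by simp_all
  define E where "E k s = indicator {0<..} s * emeasure lborel {x. s < (k x :: real)}" for k :: "real \<Rightarrow> real" and s :: real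
  have level: "ennreal (1 - l) * E f s + ennreal l * E g s \<le> E h s" for s
  proof (cases "0 < s \<and> s < 1")
    case True
    have "ennreal (1 - l) * emeasure lborel {x. s < f x} + ennreal l * emeasure lborel {x. s < g x}
        \<le> emeasure lborel {x. s < h x}"
    proof (rule brunn_minkowski_real)
      fix a b assume "a \<in> {x. s < f x}" "b \<in> {x. s < g x}"
      then have "s powr (1 - l) * s powr l < f a powr (1 - l) * g b powr l"
        using True l by (intro mult_strict_mono powr_less_mono2) auto
      also have "s powr (1 - l) * s powr l = s"
        using True by (simp add: powr_add[symmetric])
      finally show "(1 - l) * a + l * b \<in> {x. s < h x}"
        using h[of a b] by simp
    qed (use True attained l in auto)
    then show ?thesis using True by (simp add: E_def)
  next
    case False
    have "E f s = 0" "E g s = 0"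
    proof -
      have "E k s = 0" if "\<And>u. k u \<le> 1" for k :: "real \<Rightarrow> real"
      proof (cases "0 < s")
        case True
        then have "{x. s < k x} = {}" using False that by (auto simp: not_less intro: order_trans)
        then show ?thesis by (simp add: E_def)
      qed (simp add: E_def)
      then show "E f s = 0" "E g s = 0" using bd by auto
    qed
    then show ?thesis by simp
  qed
  have Em [measurable]: "E k \<in> borel_measurable borel" if [measurable]: "k \<in> borel_measurable borel" for k
    unfolding E_def by measurable
  have cake: "(\<integral>\<^sup>+u. ennreal (k u) \<partial>lborel) = (\<integral>\<^sup>+s. E k s \<partial>lborel)"
    if "k \<in> borel_measurable borel" for k
    unfolding E_def by (rule nn_integral_layer_cake[OF that])
  have "ennreal ((1 - l) * (\<integral>u. f u \<partial>lborel) + l * (\<integral>u. g u \<partial>lborel))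
      = ennreal (1 - l) * (\<integral>\<^sup>+u. ennreal (f u) \<partial>lborel) + ennreal l * (\<integral>\<^sup>+u. ennreal (g u) \<partial>lborel)"
    using l nn int by (simp add: nn_integral_eq_integral ennreal_plus ennreal_mult'[symmetric])
  also have "\<dots> = (\<integral>\<^sup>+s. ennreal (1 - l) * E f s + ennreal l * E g s \<partial>lborel)"
    unfolding cake[OF f_meas] cake[OF g_meas] by (simp add: nn_integral_add nn_integral_cmult)
  also have "\<dots> \<le> (\<integral>\<^sup>+s. E h s \<partial>lborel)"
    by (intro nn_integral_mono level)
  also have "\<dots> = ennreal (\<integral>u. h u \<partial>lborel)"
    using nn int cake[OF h_meas] by (simp add: nn_integral_eq_integral)
  finally show ?thesis
    using nn by (simp add: ennreal_le_iff integral_nonneg)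
qed

text \<open>
  Dividing f, g and h by the suprema F and G of f and g and by F^(1-l) G^l preserves the hypothesis
  and gives suprema 1. The weighted inequality between arithmetic and geometric means then turns the
  sum of the two integrals into the product.
\<close>

lemma prekopa_leindler_real:
  fixes f g h :: "real \<Rightarrow> real"
  assumes l: "0 < l" "l < 1"
    and int: "integrable lborel f" "integrable lborel g" "integrable lborel h"
    and nn: "\<And>u. 0 \<le> f u" "\<And>u. 0 \<le> g u" "\<And>u. 0 \<le> h u"
    and bd: "bdd_above (range f)" "bdd_above (range g)"
    and h: "\<And>u v. f u powr (1 - l) * g v powr l \<le> h ((1 - l) * u + l * v)"
  shows "(\<integral>u. f u \<partial>lborel) powr (1 - l) * (\<integral>u. g u \<partial>lborel) powr l \<le> (\<integral>u. h u \<partial>lborel)"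
proof (cases "(\<integral>u. f u \<partial>lborel) = 0 \<or> (\<integral>u. g u \<partial>lborel) = 0")
  case True
  then show ?thesis using nn by (auto simp: integral_nonneg)
next
  case False
  have "0 \<le> (\<integral>u. f u \<partial>lborel)" "0 \<le> (\<integral>u. g u \<partial>lborel)"
    using nn by (simp_all add: integral_nonneg)
  then have Ipos: "0 < (\<integral>u. f u \<partial>lborel)" "0 < (\<integral>u. g u \<partial>lborel)"
    using False by auto
  define F where "F = Sup (range f)"
  define G where "G = Sup (range g)"
  have leF: "f u \<le> F" and leG: "g u \<le> G" for u
    unfolding F_def G_def using bd by (auto intro: cSUP_upper)
  have "F \<noteq> 0" "G \<noteq> 0"
  proof -
    show "F \<noteq> 0"
    proof
      assume "F = 0"
      then have "f u = 0" for u using leF[of u] nn(1)[of u] by linarith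
      then show False using False by simp
    qed
    show "G \<noteq> 0"
    proof
      assume "G = 0"
      then have "g u = 0" for u using leG[of u] nn(2)[of u] by linarith
      then show False using False by simp
    qed
  qed
  then have pos: "0 < F" "0 < G"
    using leF[of 0] leG[of 0] nn(1)[of 0] nn(2)[of 0] by linarith+
  define H where "H = F powr (1 - l) * G powr l"
  have "0 < H" using pos by (simp add: H_def)
  have att: "\<exists>u. s < f u / F" "\<exists>u. s < g u / G" if "s < 1" for s
  proof -
    have "s * F < F" "s * G < G" using that pos by simp_all
    then obtain u v where "s * F < f u" "s * G < g v"
      using less_cSUP_iff[of UNIV f "s * F"] less_cSUP_iff[of UNIV g "s * G"] bd
      by (auto simp: F_def[symmetric] G_def[symmetric])
    then show "\<exists>u. s < f u / F" "\<exists>u. s < g u / G"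
      using pos by (auto simp: field_simps)
  qed
  have "(1 - l) * (\<integral>u. f u / F \<partial>lborel) + l * (\<integral>u. g u / G \<partial>lborel) \<le> (\<integral>u. h u / H \<partial>lborel)"
  proof (rule prekopa_leindler_sup_one)
    fix u v
    have "(f u / F) powr (1 - l) * (g v / G) powr l = (f u powr (1 - l) * g v powr l) / H"
      using nn pos by (simp add: powr_divide H_def)
    also have "\<dots> \<le> h ((1 - l) * u + l * v) / H"
      using \<open>0 < H\<close> h by (simp add: divide_right_mono)
    finally show "(f u / F) powr (1 - l) * (g v / G) powr l \<le> h ((1 - l) * u + l * v) / H" .
  qed (use l int nn pos \<open>0 < H\<close> leF leG att in auto)
  moreover have "((\<integral>u. f u \<partial>lborel) / F) powr (1 - l) * ((\<integral>u. g u \<partial>lborel) / G) powr l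
      \<le> (1 - l) * ((\<integral>u. f u \<partial>lborel) / F) + l * ((\<integral>u. g u \<partial>lborel) / G)"
    using l pos Ipos by (intro Youngs_inequality_0) auto
  ultimately have "((\<integral>u. f u \<partial>lborel) / F) powr (1 - l) * ((\<integral>u. g u \<partial>lborel) / G) powr l
      \<le> (\<integral>u. h u \<partial>lborel) / H" by simp
  also have "((\<integral>u. f u \<partial>lborel) / F) powr (1 - l) * ((\<integral>u. g u \<partial>lborel) / G) powr l
      = (\<integral>u. f u \<partial>lborel) powr (1 - l) * (\<integral>u. g u \<partial>lborel) powr l / H"
    using nn pos by (simp add: powr_divide H_def integral_nonneg)
  finally show ?thesis using \<open>0 < H\<close> by (simp add: divide_le_cancel)
qed

section \<open>Log-concavity under averaging over noise\<close>

definition log_concave :: "('a::real_vector \<Rightarrow> real) \<Rightarrow> bool" where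
  "log_concave f \<longleftrightarrow> (\<forall>p. 0 \<le> f p) \<and>
     (\<forall>p q l. 0 < l \<longrightarrow> l < 1 \<longrightarrow>
        f p powr (1 - l) * f q powr l \<le> f ((1 - l) *\<^sub>R p + l *\<^sub>R q))"

lemma log_concave_nonneg: "log_concave f \<Longrightarrow> 0 \<le> f p"
  by (simp add: log_concave_def)

lemma log_concaveD:
  "log_concave f \<Longrightarrow> 0 < l \<Longrightarrow> l < 1 \<Longrightarrow>
     f p powr (1 - l) * f q powr l \<le> f ((1 - l) *\<^sub>R p + l *\<^sub>R q)"
  by (simp add: log_concave_def)

lemma log_concave_pairI:
  fixes u :: "real \<Rightarrow> real \<Rightarrow> real"
  assumes "\<And>x y. 0 \<le> u x y"
    and "\<And>x0 y0 x1 y1 l. 0 < l \<Longrightarrow> l < 1 \<Longrightarrow> u x0 y0 powr (1 - l) * u x1 y1 powr l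
      \<le> u ((1 - l) * x0 + l * x1) ((1 - l) * y0 + l * y1)"
  shows "log_concave (\<lambda>(x, y). u x y)"
  using assms by (auto simp: log_concave_def)

lemma log_concave_exp:
  assumes "convex_on UNIV V" "0 < K"
  shows "log_concave (\<lambda>p. K * exp (- V p))"
  unfolding log_concave_def
proof (intro conjI allI impI)
  fix p q and l :: real assume l: "0 < l" "l < 1"
  have "(K * exp (- V p)) powr (1 - l) * (K * exp (- V q)) powr l
      = (K powr (1 - l) * K powr l) * exp (- ((1 - l) * V p + l * V q))"
    using \<open>0 < K\<close> by (simp add: powr_mult exp_powr_real exp_add[symmetric] algebra_simps)
  also have "K powr (1 - l) * K powr l = K"
    using \<open>0 < K\<close> by (simp add: powr_add[symmetric])
  also have "K * exp (- ((1 - l) * V p + l * V q)) \<le> K * exp (- V ((1 - l) *\<^sub>R p + l *\<^sub>R q))"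
    using convex_onD[OF assms(1), of l p q] l \<open>0 < K\<close> by simp
  finally show "(K * exp (- V p)) powr (1 - l) * (K * exp (- V q)) powr l
      \<le> K * exp (- V ((1 - l) *\<^sub>R p + l *\<^sub>R q))" .
qed (use assms in simp)

lemma log_concave_normal_density:
  assumes "0 < s"
  shows "log_concave (normal_density 0 s)"
proof -
  have "convex_on UNIV (\<lambda>z::real. z\<^sup>2 * (1 / (2 * s\<^sup>2)))"
    by (rule convex_on_cmul[of "1 / (2 * s\<^sup>2)" UNIV "\<lambda>z. z\<^sup>2", simplified mult.commute])
      (auto simp: convex_power2)
  then have "log_concave (\<lambda>z. (1 / sqrt (2 * pi * s\<^sup>2)) * exp (- (z\<^sup>2 * (1 / (2 * s\<^sup>2)))))"
    using assms by (intro log_concave_exp) auto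
  also have "(\<lambda>z. (1 / sqrt (2 * pi * s\<^sup>2)) * exp (- (z\<^sup>2 * (1 / (2 * s\<^sup>2))))) = normal_density 0 s"
    by (simp add: fun_eq_iff normal_density_def)
  finally show ?thesis .
qed

lemma normal_density_bdd: "bdd_above (range (normal_density 0 s))"
  by (intro bdd_aboveI[of _ "1 / sqrt (2 * pi * s\<^sup>2)"])
    (auto simp: normal_density_def intro!: divide_right_mono)

lemma integrable_mult_density:
  fixes D g :: "real \<Rightarrow> real"
  assumes D: "integrable lborel D" "\<And>z. 0 \<le> D z"
    and g: "g \<in> borel_measurable borel" "\<And>z. 0 \<le> g z" "\<And>z. g z \<le> 1"
  shows "integrable lborel (\<lambda>z. g z * D z)"
proof (rule Bochner_Integration.integrable_bound[OF D(1)])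
  have "D \<in> borel_measurable borel" using borel_measurable_integrable[OF D(1)] by simp
  then show "(\<lambda>z. g z * D z) \<in> borel_measurable lborel" using g by simp
  show "AE z in lborel. norm (g z * D z) \<le> norm (D z)"
    using D(2) g by (intro AE_I2) (simp add: abs_mult mult_left_le_one_le)
qed

text \<open>
  The integrand is log-concave jointly in (x, y, z): concavity of \<phi> moves the convex
  combination inside \<phi> y + c z, and monotonicity of u in its second argument makes this go in
  the right direction. Integrating z out preserves log-concavity by Prekopa-Leindler.
\<close>

lemma log_concave_noise_average:
  fixes u :: "real \<Rightarrow> real \<Rightarrow> real" and \<phi> D :: "real \<Rightarrow> real"
  assumes u: "log_concave (\<lambda>(x, y). u x y)" "\<And>x. mono (u x)" "\<And>x y. u x y \<le> 1"
    and \<phi>: "concave_on UNIV \<phi>"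
    and D: "log_concave D" "integrable lborel D" "bdd_above (range D)"
  shows "log_concave (\<lambda>(x, y). \<integral>z. u x (\<phi> y + c * z) * D z \<partial>lborel)"
proof -
  have u0: "0 \<le> u x y" for x y using log_concave_nonneg[OF u(1), of "(x, y)"] by simp
  have D0: "0 \<le> D z" for z using log_concave_nonneg[OF D(1)] .
  have [measurable]: "u x \<in> borel_measurable borel" for x
    by (rule borel_measurable_mono[OF u(2)])
  have int: "integrable lborel (\<lambda>z. u x (\<phi> y + c * z) * D z)" for x y
    by (rule integrable_mult_density) (use D D0 u u0 in auto)
  have bdd: "bdd_above (range (\<lambda>z. u x (\<phi> y + c * z) * D z))" for x y
  proof -
    obtain B where B: "\<And>z. D z \<le> B" using D(3) by (auto simp: bdd_above_def)
    have "u x (\<phi> y + c * z) * D z \<le> B" for z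
      using mult_right_mono[OF u(3) D0, of x "\<phi> y + c * z" z] B[of z] by simp
    then show ?thesis by (intro bdd_aboveI[of _ B]) auto
  qed
  show ?thesis
  proof (rule log_concave_pairI)
    fix x y show "0 \<le> (\<integral>z. u x (\<phi> y + c * z) * D z \<partial>lborel)"
      using u0 D0 by simp
  next
    fix x0 y0 x1 y1 l :: real assume l: "0 < l" "l < 1"
    define x where "x = (1 - l) * x0 + l * x1"
    define y where "y = (1 - l) * y0 + l * y1"
    show "(\<integral>z. u x0 (\<phi> y0 + c * z) * D z \<partial>lborel) powr (1 - l)
        * (\<integral>z. u x1 (\<phi> y1 + c * z) * D z \<partial>lborel) powr l
        \<le> (\<integral>z. u ((1 - l) * x0 + l * x1) (\<phi> ((1 - l) * y0 + l * y1) + c * z) * D z \<partial>lborel)"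
      unfolding x_def[symmetric] y_def[symmetric]
    proof (rule prekopa_leindler_real[OF l int int int])
      fix a b :: real
      let ?z = "(1 - l) * a + l * b"
      have "(u x0 (\<phi> y0 + c * a) * D a) powr (1 - l) * (u x1 (\<phi> y1 + c * b) * D b) powr l
          = (u x0 (\<phi> y0 + c * a) powr (1 - l) * u x1 (\<phi> y1 + c * b) powr l)
            * (D a powr (1 - l) * D b powr l)"
        using u0 D0 by (simp add: powr_mult)
      also have "\<dots> \<le> u x ((1 - l) * (\<phi> y0 + c * a) + l * (\<phi> y1 + c * b)) * D ?z"
      proof (rule mult_mono)
        show "u x0 (\<phi> y0 + c * a) powr (1 - l) * u x1 (\<phi> y1 + c * b) powr l
            \<le> u x ((1 - l) * (\<phi> y0 + c * a) + l * (\<phi> y1 + c * b))"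
          using log_concaveD[OF u(1) l, of "(x0, \<phi> y0 + c * a)" "(x1, \<phi> y1 + c * b)"]
          by (simp add: x_def)
        show "D a powr (1 - l) * D b powr l \<le> D ?z"
          using log_concaveD[OF D(1) l, of a b] by simp
      qed (use u0 in auto)
      also have "\<dots> \<le> u x (\<phi> y + c * ?z) * D ?z"
      proof -
        have "(1 - l) * \<phi> y0 + l * \<phi> y1 \<le> \<phi> y"
          using concave_onD[OF \<phi>, of l y0 y1] l by (simp add: y_def)
        then have "(1 - l) * (\<phi> y0 + c * a) + l * (\<phi> y1 + c * b) \<le> \<phi> y + c * ?z"
          by (simp add: algebra_simps)
        then show ?thesis
          using monoD[OF u(2)] D0 by (intro mult_right_mono) auto
      qed
      finally show "(u x0 (\<phi> y0 + c * a) * D a) powr (1 - l) * (u x1 (\<phi> y1 + c * b) * D b) powr l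
          \<le> u x (\<phi> y + c * ?z) * D ?z" .
    qed (use u0 D0 bdd in auto)
  qed
qed

section \<open>Tail probabilities of a chain with Gaussian noise\<close>

text \<open>
  The probability that the chain with drift maps \<phi> and independent centred Gaussian increments
  of standard deviation s, scaled by c, exceeds x after n further steps when it is at y at time k.
  It is defined by backward recursion because log-concavity and the comparison of drifts pass from
  one time to the preceding one.
\<close>

primrec chain_tail :: "(nat \<Rightarrow> real \<Rightarrow> real) \<Rightarrow> real \<Rightarrow> real \<Rightarrow> nat \<Rightarrow> nat \<Rightarrow> real \<Rightarrow> real \<Rightarrow> real" where
  "chain_tail \<phi> c s 0 k x y = indicator {x<..} y"
| "chain_tail \<phi> c s (Suc n) k x y
     = (\<integral>z. chain_tail \<phi> c s n (Suc k) x (\<phi> k y + c * z) * normal_density 0 s z \<partial>lborel)"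

lemma chain_tail_basic:
  assumes \<phi>: "\<And>k. mono (\<phi> k)" and "0 < s"
  shows "mono (chain_tail \<phi> c s n k x) \<and> (\<forall>y. 0 \<le> chain_tail \<phi> c s n k x y \<and> chain_tail \<phi> c s n k x y \<le> 1)"
proof (induction n arbitrary: k)
  case 0
  then show ?case by (auto simp: mono_def indicator_def)
next
  case (Suc n)
  have [measurable]: "chain_tail \<phi> c s n (Suc k) x \<in> borel_measurable borel"
    using borel_measurable_mono Suc by blast
  have int: "integrable lborel (\<lambda>z. chain_tail \<phi> c s n (Suc k) x (\<phi> k y + c * z) * normal_density 0 s z)" for y
    by (rule integrable_mult_density) (use Suc \<open>0 < s\<close> in auto)
  have "chain_tail \<phi> c s (Suc n) k x y \<le> (\<integral>z. normal_density 0 s z \<partial>lborel)" for y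
    unfolding chain_tail.simps
    by (rule integral_mono[OF int]) (use Suc \<open>0 < s\<close> in \<open>auto intro: mult_left_le_one_le\<close>)
  moreover have "mono (chain_tail \<phi> c s (Suc n) k x)"
    unfolding chain_tail.simps
    using monoD[OF \<phi>] Suc by (intro monoI integral_mono int mult_right_mono) (auto simp: mono_def)
  moreover have "0 \<le> chain_tail \<phi> c s (Suc n) k x y" for y
    using Suc \<open>0 < s\<close> by simp
  ultimately show ?case
    using \<open>0 < s\<close> by (simp del: chain_tail.simps)
qed

lemma chain_tail_measurable:
  assumes "\<And>k. mono (\<phi> k)" "0 < s"
  shows "chain_tail \<phi> c s n k x \<in> borel_measurable borel"
  using chain_tail_basic[OF assms] by (intro borel_measurable_mono) auto

lemma log_concave_indicator_less: "log_concave (\<lambda>(x :: real, y). indicator {x<..} y :: real)"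
proof (rule log_concave_pairI[where u = "\<lambda>x y. indicator {x<..} y"])
  fix x0 y0 x1 y1 l :: real assume l: "0 < l" "l < 1"
  have "(1 - l) * x0 + l * x1 < (1 - l) * y0 + l * y1" if "x0 < y0" "x1 < y1"
    using that l by (intro add_strict_mono mult_strict_left_mono) auto
  then show "(indicator {x0<..} y0 :: real) powr (1 - l) * indicator {x1<..} y1 powr l
      \<le> indicator {(1 - l) * x0 + l * x1<..} ((1 - l) * y0 + l * y1)"
    by (auto simp: indicator_def)
qed (auto simp: indicator_def)

lemma log_concave_chain_tail:
  assumes \<phi>: "\<And>k. mono (\<phi> k)" "\<And>k. concave_on UNIV (\<phi> k)" and "0 < s"
  shows "log_concave (\<lambda>(x, y). chain_tail \<phi> c s n k x y)"
proof (induction n arbitrary: k)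
  case 0
  then show ?case using log_concave_indicator_less by simp
next
  case (Suc n)
  show ?case
    unfolding chain_tail.simps
    by (rule log_concave_noise_average[OF Suc])
      (use chain_tail_basic[OF \<phi>(1) \<open>0 < s\<close>] \<phi> \<open>0 < s\<close> in
        \<open>auto simp: log_concave_normal_density normal_density_bdd\<close>)
qed

text \<open>
  A one-step Cameron-Martin estimate: shifting a Gaussian by d costs at most a square and the factor
  exp (- (d/s)^2), the reciprocal of the second moment of the likelihood ratio. It is the
  Cauchy-Schwarz inequality, obtained by integrating the square of g D - \<theta> D(. - d) divided
  by D and choosing the best \<theta>.
\<close>

lemma normal_shift_square:
  fixes g :: "real \<Rightarrow> real"
  assumes [measurable]: "g \<in> borel_measurable borel"
    and g: "\<And>z. 0 \<le> g z" "\<And>z. g z \<le> 1" and "0 < s"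
  shows "exp (- (d / s)\<^sup>2) * (\<integral>z. g z * normal_density 0 s (z - d) \<partial>lborel)\<^sup>2
    \<le> (\<integral>z. (g z)\<^sup>2 * normal_density 0 s z \<partial>lborel)"
proof -
  let ?D = "normal_density 0 s"
  let ?I = "\<integral>z. g z * ?D (z - d) \<partial>lborel"
  define \<kappa> where "\<kappa> = exp ((d / s)\<^sup>2)"
  \<comment> \<open>This choice maximises the lower bound \<open>2 * \<theta> * ?I - \<theta>\<^sup>2 * \<kappa>\<close> obtained below.\<close>
  define \<theta> where "\<theta> = ?I / \<kappa>"
  have \<kappa>: "0 < \<kappa>" by (simp add: \<kappa>_def)
  have shift: "?D (z - a) = normal_density a s z" for a z
    by (simp add: normal_density_def)
  have ratio: "?D (z - d) ^ 2 = \<kappa> * normal_density (2 * d) s z * ?D z" for z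
  proof -
    have "exp (- (z - d)\<^sup>2 / (2 * s\<^sup>2)) ^ 2
        = exp ((d / s)\<^sup>2) * exp (- (z - 2 * d)\<^sup>2 / (2 * s\<^sup>2)) * exp (- z\<^sup>2 / (2 * s\<^sup>2))"
      using \<open>0 < s\<close>
      by (simp add: exp_double[symmetric] exp_add[symmetric] power2_eq_square field_simps)
    then show ?thesis
      by (simp add: normal_density_def \<kappa>_def power_mult_distrib power2_eq_square) 
  qed
  have pointwise: "2 * \<theta> * (g z * normal_density d s z) - \<theta>\<^sup>2 * (\<kappa> * normal_density (2 * d) s z)
      \<le> (g z)\<^sup>2 * ?D z" for z
  proof -
    have D: "0 < ?D z" using \<open>0 < s\<close> by (simp add: normal_density_pos)
    have "0 \<le> (g z * ?D z - \<theta> * ?D (z - d))\<^sup>2" by simp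
    also have "\<dots> = ((g z)\<^sup>2 * ?D z - 2 * \<theta> * (g z * normal_density d s z)
        + \<theta>\<^sup>2 * (\<kappa> * normal_density (2 * d) s z)) * ?D z"
      using ratio[of z] by (simp add: power2_diff power_mult_distrib shift power2_eq_square algebra_simps)
    finally show ?thesis
      using D by (simp add: zero_le_mult_iff)
  qed
  have int1: "integrable lborel (\<lambda>z. g z * normal_density d s z)"
    by (rule integrable_mult_density) (use g \<open>0 < s\<close> in auto)
  have int2: "integrable lborel (\<lambda>z. (g z)\<^sup>2 * ?D z)"
    by (rule integrable_mult_density) (use g \<open>0 < s\<close> in \<open>auto simp: power_le_one\<close>)
  have "2 * \<theta> * ?I - \<theta>\<^sup>2 * \<kappa>
      = (\<integral>z. 2 * \<theta> * (g z * normal_density d s z) - \<theta>\<^sup>2 * (\<kappa> * normal_density (2 * d) s z) \<partial>lborel)"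
    using int1 \<open>0 < s\<close> by (simp add: shift Bochner_Integration.integral_diff)
  also have "\<dots> \<le> (\<integral>z. (g z)\<^sup>2 * ?D z \<partial>lborel)"
    using int1 int2 pointwise \<open>0 < s\<close>
    by (intro integral_mono Bochner_Integration.integrable_diff integrable_mult_right) auto
  also have "2 * \<theta> * ?I - \<theta>\<^sup>2 * \<kappa> = ?I\<^sup>2 / \<kappa>"
    using \<kappa> by (simp add: \<theta>_def power2_eq_square field_simps)
  also have "\<dots> = exp (- (d / s)\<^sup>2) * ?I\<^sup>2"
    by (simp add: \<kappa>_def exp_minus field_simps)
  finally show ?thesis .
qed

text \<open>
  Drift terms m can be absorbed into the noise one step at a time. The square does not compound over
  the steps: the one-step estimate puts the square of the steered tail under the integral, and
  there the bound for the later tail applies.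
\<close>

lemma chain_tail_shifted_drift:
  assumes \<phi>: "\<And>k. mono (\<phi> k)" and "0 < s" "0 < c" and m: "\<And>k. \<bar>m k\<bar> \<le> \<mu>"
  shows "exp (- (real n * (\<mu> / (c * s))\<^sup>2)) * (chain_tail (\<lambda>k y. \<phi> k y + m k) c s n k x y)\<^sup>2
    \<le> chain_tail \<phi> c s n k x y"
proof (induction n arbitrary: k y)
  case 0
  then show ?case by (simp add: indicator_def)
next
  case (Suc n)
  let ?\<phi> = "\<lambda>k y. \<phi> k y + m k"
  let ?E = "exp (- (real n * (\<mu> / (c * s))\<^sup>2))"
  define g where "g z = chain_tail ?\<phi> c s n (Suc k) x (\<phi> k y + c * z)" for z
  have mono: "mono (?\<phi> k)" for k using \<phi>[of k] by (auto simp: mono_def)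
  note basic = chain_tail_basic[OF mono \<open>0 < s\<close>]
  note [measurable] = chain_tail_measurable[OF mono \<open>0 < s\<close>] chain_tail_measurable[OF \<phi> \<open>0 < s\<close>]
  have [measurable]: "g \<in> borel_measurable borel" unfolding g_def by measurable
  have g: "0 \<le> g z" "g z \<le> 1" for z using basic by (auto simp: g_def)
  define d where "d = m k / c"
  have "chain_tail ?\<phi> c s (Suc n) k x y
      = (\<integral>z. g (d + 1 * z) * normal_density 0 s (d + 1 * z - d) \<partial>lborel)"
    using \<open>0 < c\<close> by (simp add: g_def d_def algebra_simps)
  also have "\<dots> = (\<integral>z. g z * normal_density 0 s (z - d) \<partial>lborel)"
    using lborel_integral_real_affine[of 1 "\<lambda>z. g z * normal_density 0 s (z - d)" d] by simp
  finally have eq: "chain_tail ?\<phi> c s (Suc n) k x y = (\<integral>z. g z * normal_density 0 s (z - d) \<partial>lborel)" .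
  have "(d / s)\<^sup>2 \<le> (\<mu> / (c * s))\<^sup>2"
  proof -
    have "\<bar>d / s\<bar> \<le> \<mu> / (c * s)"
      using m[of k] \<open>0 < c\<close> \<open>0 < s\<close> by (simp add: d_def abs_divide divide_right_mono)
    then show ?thesis by (metis abs_ge_zero order_trans power2_abs power_mono)
  qed
  then have "exp (- (real (Suc n) * (\<mu> / (c * s))\<^sup>2)) \<le> ?E * exp (- (d / s)\<^sup>2)"
    by (simp add: exp_add[symmetric] algebra_simps)
  then have "exp (- (real (Suc n) * (\<mu> / (c * s))\<^sup>2)) * (chain_tail ?\<phi> c s (Suc n) k x y)\<^sup>2
      \<le> ?E * (exp (- (d / s)\<^sup>2) * (chain_tail ?\<phi> c s (Suc n) k x y)\<^sup>2)"
    by (simp only: mult.assoc[symmetric]) (rule mult_right_mono, auto)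
  also have "\<dots> \<le> ?E * (\<integral>z. (g z)\<^sup>2 * normal_density 0 s z \<partial>lborel)"
    unfolding eq by (intro mult_left_mono normal_shift_square g \<open>0 < s\<close>) auto
  also have "\<dots> = (\<integral>z. ?E * ((g z)\<^sup>2 * normal_density 0 s z) \<partial>lborel)" by simp
  also have "\<dots> \<le> chain_tail \<phi> c s (Suc n) k x y"
    unfolding chain_tail.simps
  proof (rule integral_mono)
    show "integrable lborel (\<lambda>z. ?E * ((g z)\<^sup>2 * normal_density 0 s z))"
      using g \<open>0 < s\<close> by (intro integrable_mult_right integrable_mult_density) (auto simp: power_le_one)
    show "integrable lborel (\<lambda>z. chain_tail \<phi> c s n (Suc k) x (\<phi> k y + c * z) * normal_density 0 s z)"
      using chain_tail_basic[OF \<phi> \<open>0 < s\<close>] \<open>0 < s\<close> by (intro integrable_mult_density) auto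
    fix z
    show "?E * ((g z)\<^sup>2 * normal_density 0 s z)
        \<le> chain_tail \<phi> c s n (Suc k) x (\<phi> k y + c * z) * normal_density 0 s z"
      using mult_right_mono[OF Suc[of "Suc k" "\<phi> k y + c * z"], of "normal_density 0 s z"] \<open>0 < s\<close>
      by (simp add: g_def mult.assoc)
  qed
  finally show ?case .
qed

section \<open>The chain as a random variable\<close>

primrec noisy_chain :: "(nat \<Rightarrow> real \<Rightarrow> real) \<Rightarrow> real \<Rightarrow> (nat \<Rightarrow> real) \<Rightarrow> real \<Rightarrow> nat \<Rightarrow> real" where
  "noisy_chain \<phi> c z y 0 = y"
| "noisy_chain \<phi> c z y (Suc k) = \<phi> k (noisy_chain \<phi> c z y k) + c * z k"

lemma noisy_chain_cong:
  "(\<And>i. i < k \<Longrightarrow> z i = z' i) \<Longrightarrow> noisy_chain \<phi> c z y k = noisy_chain \<phi> c z' y k"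
  by (induction k) simp_all

lemma noisy_chain_measurable:
  assumes [measurable]: "\<And>k. \<phi> k \<in> borel_measurable borel"
    and Z: "\<And>i. i < k \<Longrightarrow> (\<lambda>\<omega>. Z \<omega> i) \<in> borel_measurable M"
  shows "(\<lambda>\<omega>. noisy_chain \<phi> c (Z \<omega>) y k) \<in> borel_measurable M"
  using Z
proof (induction k)
  case (Suc k)
  have [measurable]: "(\<lambda>\<omega>. noisy_chain \<phi> c (Z \<omega>) y k) \<in> borel_measurable M" "(\<lambda>\<omega>. Z \<omega> k) \<in> borel_measurable M"
    using Suc by auto
  show ?case by simp
qed simp

lemma (in prob_space) indep_noisy_chain:
  assumes \<phi>: "\<And>k. \<phi> k \<in> borel_measurable borel"
    and indep: "indep_vars (\<lambda>_. borel) Z {..<N}" and "k < N"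
  shows "indep_var borel (\<lambda>\<omega>. noisy_chain \<phi> c (\<lambda>i. Z i \<omega>) y k) borel (Z k)"
proof -
  have "indep_var
      borel ((\<lambda>f. noisy_chain \<phi> c f y k) \<circ> (\<lambda>\<omega>. restrict (\<lambda>i. Z i \<omega>) {..<k}))
      borel ((\<lambda>f. f k) \<circ> (\<lambda>\<omega>. restrict (\<lambda>i. Z i \<omega>) {k}))"
    using \<open>k < N\<close> \<phi>
    by (intro indep_var_compose[OF indep_var_restrict[OF indep]] noisy_chain_measurable) auto
  also have "(\<lambda>f. f k) \<circ> (\<lambda>\<omega>. restrict (\<lambda>i. Z i \<omega>) {k}) = Z k" by auto
  also have "(\<lambda>f. noisy_chain \<phi> c f y k) \<circ> (\<lambda>\<omega>. restrict (\<lambda>i. Z i \<omega>) {..<k})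
      = (\<lambda>\<omega>. noisy_chain \<phi> c (\<lambda>i. Z i \<omega>) y k)"
    by (auto simp: fun_eq_iff intro!: noisy_chain_cong)
  finally show ?thesis .
qed

lemma (in prob_space) expectation_indep_noise:
  fixes X Z :: "'a \<Rightarrow> real" and G :: "real \<Rightarrow> real \<Rightarrow> real"
  assumes indep: "indep_var borel X borel Z"
    and Z: "distributed M lborel Z D" and D: "\<And>z. 0 \<le> D z" "D \<in> borel_measurable borel"
    and G [measurable]: "case_prod G \<in> borel_measurable (borel \<Otimes>\<^sub>M borel)"
    and bd: "\<And>x z. \<bar>G x z\<bar> \<le> B"
  shows "expectation (\<lambda>\<omega>. G (X \<omega>) (Z \<omega>)) = expectation (\<lambda>\<omega>. \<integral>z. G (X \<omega>) z * D z \<partial>lborel)"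
proof -
  have XZ [measurable]: "X \<in> borel_measurable M" "Z \<in> borel_measurable M"
    using indep by (auto simp: indep_var_distribution_eq)
  have joint: "distr M (borel \<Otimes>\<^sub>M borel) (\<lambda>\<omega>. (X \<omega>, Z \<omega>)) = distr M borel X \<Otimes>\<^sub>M distr M borel Z"
    using indep by (simp add: indep_var_distribution_eq)
  interpret X: prob_space "distr M borel X" by (rule prob_space_distr) simp
  interpret Z: prob_space "distr M borel Z" by (rule prob_space_distr) simp
  interpret XZ: pair_prob_space "distr M borel X" "distr M borel Z" ..
  have law: "distr M borel Z = density lborel D"
    using distributed_distr_eq_density[OF Z] by (simp cong: distr_cong)
  have "expectation (\<lambda>\<omega>. G (X \<omega>) (Z \<omega>))
      = (\<integral>p. case_prod G p \<partial>(distr M borel X \<Otimes>\<^sub>M distr M borel Z))"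
    by (simp add: joint[symmetric] integral_distr)
  also have "\<dots> = (\<integral>x. \<integral>z. G x z \<partial>distr M borel Z \<partial>distr M borel X)"
  proof (rule XZ.integral_fst[symmetric])
    show "integrable (distr M borel X \<Otimes>\<^sub>M distr M borel Z) (case_prod G)"
      using bd G by (intro XZ.integrable_const_bound[where B = B]) (auto cong: measurable_cong_sets)
  qed
  also have "\<dots> = (\<integral>x. \<integral>z. G x z * D z \<partial>lborel \<partial>distr M borel X)"
    using D by (simp add: law integral_density mult.commute)
  also have "\<dots> = expectation (\<lambda>\<omega>. \<integral>z. G (X \<omega>) z * D z \<partial>lborel)"
    using D by (intro integral_distr) simp_all
  finally show ?thesis .
qed

text \<open>
  The tail function evaluated along the chain has constant expectation. Each step of the backward
  recursion integrates out the noise of that step, which is independent of the chain so far.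
\<close>

lemma (in prob_space) expectation_chain_tail:
  assumes \<phi>: "\<And>k. mono (\<phi> k)" and "0 < s"
    and indep: "indep_vars (\<lambda>_. borel) Z {..<N}"
    and Z: "\<And>k. k < N \<Longrightarrow> distributed M lborel (Z k) (normal_density 0 s)"
    and "k + n \<le> N"
  shows "expectation (\<lambda>\<omega>. chain_tail \<phi> c s n k x (noisy_chain \<phi> c (\<lambda>i. Z i \<omega>) y k))
    = prob {\<omega> \<in> space M. x < noisy_chain \<phi> c (\<lambda>i. Z i \<omega>) y (k + n)}"
  using \<open>k + n \<le> N\<close>
proof (induction n arbitrary: k)
  case 0
  have meas: "\<And>k. \<phi> k \<in> borel_measurable borel" by (rule borel_measurable_mono[OF \<phi>])
  have Zm: "Z i \<in> borel_measurable M" if "i < N" for i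
    using distributed_measurable[OF Z[OF that]] by simp
  have [measurable]: "(\<lambda>\<omega>. noisy_chain \<phi> c (\<lambda>i. Z i \<omega>) y k) \<in> borel_measurable M"
    using 0 Zm meas by (intro noisy_chain_measurable) auto
  have "expectation (\<lambda>\<omega>. chain_tail \<phi> c s 0 k x (noisy_chain \<phi> c (\<lambda>i. Z i \<omega>) y k))
      = expectation (indicator {\<omega> \<in> space M. x < noisy_chain \<phi> c (\<lambda>i. Z i \<omega>) y k})"
    by (intro Bochner_Integration.integral_cong) (auto simp: indicator_def)
  then show ?case by simp
next
  case (Suc n)
  note basic = chain_tail_basic[OF \<phi> \<open>0 < s\<close>]
  have meas [measurable]: "\<And>k. \<phi> k \<in> borel_measurable borel" by (rule borel_measurable_mono[OF \<phi>])
  have [measurable]: "chain_tail \<phi> c s n (Suc k) x \<in> borel_measurable borel"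
    by (rule chain_tail_measurable[OF \<phi> \<open>0 < s\<close>])
  have "expectation (\<lambda>\<omega>. chain_tail \<phi> c s (Suc n) k x (noisy_chain \<phi> c (\<lambda>i. Z i \<omega>) y k))
      = expectation (\<lambda>\<omega>. chain_tail \<phi> c s n (Suc k) x (noisy_chain \<phi> c (\<lambda>i. Z i \<omega>) y (Suc k)))"
    unfolding chain_tail.simps noisy_chain.simps
  proof (rule expectation_indep_noise[symmetric, where B = 1
        and G = "\<lambda>v z. chain_tail \<phi> c s n (Suc k) x (\<phi> k v + c * z)"
        and X = "\<lambda>\<omega>. noisy_chain \<phi> c (\<lambda>i. Z i \<omega>) y k"])
    show "indep_var borel (\<lambda>\<omega>. noisy_chain \<phi> c (\<lambda>i. Z i \<omega>) y k) borel (Z k)"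
      using Suc.prems by (intro indep_noisy_chain[OF meas indep]) auto
    show "distributed M lborel (Z k) (normal_density 0 s)" using Z Suc.prems by auto
  qed (use basic in \<open>auto simp: abs_le_iff intro: order_trans[of _ 0]\<close>)
  then show ?case using Suc.IH[of "Suc k"] Suc.prems by simp
qed

corollary (in prob_space) prob_noisy_chain:
  assumes "\<And>k. mono (\<phi> k)" "0 < s"
    and "indep_vars (\<lambda>_. borel) Z {..<N}"
    and "\<And>k. k < N \<Longrightarrow> distributed M lborel (Z k) (normal_density 0 s)"
  shows "prob {\<omega> \<in> space M. x < noisy_chain \<phi> c (\<lambda>i. Z i \<omega>) y N} = chain_tail \<phi> c s N 0 x y"
  using expectation_chain_tail[OF assms, where k = 0 and n = N] prob_space by simp

section \<open>The Euler scheme along a path\<close>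

lemma discrete_gronwall:
  fixes e :: "nat \<Rightarrow> real"
  assumes step: "\<And>k. k < N \<Longrightarrow> e (Suc k) \<le> (1 + r) * e k + d"
    and "0 \<le> r" "0 \<le> d" "0 \<le> e 0" and "k \<le> N"
  shows "e k \<le> exp (real k * r) * (e 0 + real k * d)"
  using \<open>k \<le> N\<close>
proof (induction k)
  case (Suc k)
  have "e (Suc k) \<le> (1 + r) * e k + d" using step Suc.prems by auto
  also have "\<dots> \<le> exp r * (exp (real k * r) * (e 0 + real k * d)) + exp (real (Suc k) * r) * d"
  proof (rule add_mono)
    show "(1 + r) * e k \<le> exp r * (exp (real k * r) * (e 0 + real k * d))"
      using Suc assms exp_ge_add_one_self[of r]
      by (intro order_trans[OF mult_left_mono[OF Suc.IH]] mult_right_mono) auto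
    have "1 \<le> exp (real (Suc k) * r)" using \<open>0 \<le> r\<close> by simp
    from mult_right_mono[OF this \<open>0 \<le> d\<close>] show "d \<le> exp (real (Suc k) * r) * d" by simp
  qed
  also have "\<dots> = exp (real (Suc k) * r) * (e 0 + real (Suc k) * d)"
    by (simp add: exp_add algebra_simps)
  finally show ?case .
qed simp

text \<open>
  The index is capped at N, so that every drift map is evaluated at a time in [t, T], where
  the drift is concave and Lipschitz. Thus the maps have these properties for all indices, as the
  lemmas on chains require.
\<close>

definition grid :: "real \<Rightarrow> real \<Rightarrow> nat \<Rightarrow> nat \<Rightarrow> real" where
  "grid t T N k = t + real (min k N) * ((T - t) / real N)"

definition euler_map ::
  "(real \<Rightarrow> real \<Rightarrow> real) \<Rightarrow> real \<Rightarrow> real \<Rightarrow> nat \<Rightarrow> nat \<Rightarrow> real \<Rightarrow> real" where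
  "euler_map b t T N k y = y + (T - t) / real N * b y (grid t T N k)"

lemma grid_0 [simp]: "grid t T N 0 = t"
  by (simp add: grid_def)

lemma grid_N [simp]: "0 < N \<Longrightarrow> grid t T N N = T"
  by (simp add: grid_def)

lemma grid_Suc: "k < N \<Longrightarrow> grid t T N (Suc k) = grid t T N k + (T - t) / real N"
proof -
  assume "k < N"
  then have "real (min (Suc k) N) = real (min k N) + 1" by simp
  then show ?thesis by (simp only: grid_def distrib_right)
qed

lemma grid_mem:
  assumes "t < T" shows "grid t T N k \<in> {t..T}"
proof -
  have "real (min k N) * ((T - t) / real N) \<le> real N * ((T - t) / real N)"
    using assms by (intro mult_right_mono) auto
  also have "\<dots> \<le> T - t" using assms by simp
  finally show ?thesis using assms by (simp add: grid_def)
qed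

lemma mono_euler_map:
  assumes lip: "\<And>u v s. s \<le> T \<Longrightarrow> \<bar>b u s - b v s\<bar> \<le> A * \<bar>u - v\<bar>"
    and "t < T" and h: "(T - t) / real N * A \<le> 1"
  shows "mono (euler_map b t T N k)"
proof (rule monoI)
  fix u v :: real assume "u \<le> v"
  let ?h = "(T - t) / real N"
  have "b u (grid t T N k) - b v (grid t T N k) \<le> A * (v - u)"
    using lip[of "grid t T N k" u v] grid_mem[OF \<open>t < T\<close>, of N k] \<open>u \<le> v\<close> by simp
  then have "?h * (b u (grid t T N k) - b v (grid t T N k)) \<le> ?h * (A * (v - u))"
    using \<open>t < T\<close> by (intro mult_left_mono) auto
  also have "\<dots> \<le> 1 * (v - u)"
    unfolding mult.assoc[symmetric] using h \<open>u \<le> v\<close> by (intro mult_right_mono) auto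
  finally show "euler_map b t T N k u \<le> euler_map b t T N k v"
    by (simp add: euler_map_def right_diff_distrib)
qed

lemma concave_euler_map:
  assumes conc: "\<And>s. s \<le> T \<Longrightarrow> concave_on UNIV (\<lambda>y. b y s)" and "t < T"
  shows "concave_on UNIV (euler_map b t T N k)"
proof -
  have "grid t T N k \<le> T" using grid_mem[OF \<open>t < T\<close>, of N k] by simp
  then have "convex_on UNIV (\<lambda>y. - b y (grid t T N k))"
    using conc by (simp add: concave_on_def)
  then have "convex_on UNIV (\<lambda>y. (T - t) / real N * - b y (grid t T N k))"
    using \<open>t < T\<close> by (intro convex_on_cmul) auto
  moreover have "convex_on UNIV (\<lambda>y::real. - y)"
    by (intro convex_onI) (auto simp: algebra_simps)
  ultimately have "convex_on UNIV (\<lambda>y. - y + (T - t) / real N * - b y (grid t T N k))"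
    by (intro convex_on_add)
  then show ?thesis
    by (simp add: concave_on_def euler_map_def)
qed

lemma continuous_on_along_path:
  fixes b :: "real \<Rightarrow> real \<Rightarrow> real"
  assumes "continuous_on (UNIV \<times> {..T}) (\<lambda>(y, t). b y t)" "continuous_on {t..T} p"
  shows "continuous_on {t..T} (\<lambda>r. b (p r) r)"
proof -
  have "continuous_on {t..T} (\<lambda>r. (\<lambda>(y, t). b y t) (p r, r))"
    by (rule continuous_on_compose2[OF assms(1)]) (auto intro!: continuous_intros assms(2))
  then show ?thesis by simp
qed

text \<open>
  The noise is additive, so it cancels in the difference of the solution and the scheme. The local
  error is then h times the modulus of continuity of r \<mapsto> b (Y r) r at scale h, which is
  uniform on [t, T], and Gronwall's inequality sums the local errors.
\<close>

lemma euler_converges: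
  fixes b :: "real \<Rightarrow> real \<Rightarrow> real" and Y w :: "real \<Rightarrow> real"
  assumes "t < T" "0 \<le> A"
    and b: "continuous_on (UNIV \<times> {..T}) (\<lambda>(y, t). b y t)"
    and lip: "\<And>u v s. s \<le> T \<Longrightarrow> \<bar>b u s - b v s\<bar> \<le> A * \<bar>u - v\<bar>"
    and Y: "continuous_on {t..T} Y"
    and eq: "\<And>s. s \<in> {t..T} \<Longrightarrow> Y s = y + integral {t..s} (\<lambda>r. b (Y r) r) + c * (w s - w t)"
  shows "(\<lambda>N. noisy_chain (euler_map b t T N) c
    (\<lambda>i. w (grid t T N (Suc i)) - w (grid t T N i)) y N) \<longlonglongrightarrow> Y T"
proof (rule LIMSEQ_I)
  fix e :: real assume "0 < e"
  define B where "B r = b (Y r) r" for r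
  have contB: "continuous_on {t..T} B"
    unfolding B_def by (rule continuous_on_along_path[OF b Y])
  have eqB: "Y s = y + integral {t..s} B + c * (w s - w t)" if "s \<in> {t..T}" for s
    using eq[OF that] by (simp add: B_def[abs_def])
  define C where "C = exp ((T - t) * A) * (T - t)"
  have "0 < C" using \<open>t < T\<close> by (simp add: C_def)
  define \<eta> where "\<eta> = e / (2 * C)"
  have "0 < \<eta>" using \<open>0 < e\<close> \<open>0 < C\<close> by (simp add: \<eta>_def)
  obtain \<delta> where "0 < \<delta>" and \<delta>: "\<And>r r'. r \<in> {t..T} \<Longrightarrow> r' \<in> {t..T} \<Longrightarrow> dist r' r < \<delta> \<Longrightarrow> dist (B r') (B r) < \<eta>"
    using compact_uniformly_continuous[OF contB] \<open>0 < \<eta>\<close> unfolding uniformly_continuous_on_def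
    by (metis compact_Icc)
  obtain N0 :: nat where N0: "(T - t) / \<delta> < real N0" using reals_Archimedean2 by blast
  show "\<exists>no. \<forall>N\<ge>no. norm (noisy_chain (euler_map b t T N) c
      (\<lambda>i. w (grid t T N (Suc i)) - w (grid t T N i)) y N - Y T) < e"
  proof (intro exI allI impI)
    fix N assume "N0 \<le> N"
    define h where "h = (T - t) / real N"
    have "(T - t) / \<delta> < real N" using N0 \<open>N0 \<le> N\<close> by linarith
    moreover have "0 < (T - t) / \<delta>" using \<open>t < T\<close> \<open>0 < \<delta>\<close> by simp
    ultimately have "0 < N" by (metis less_trans of_nat_0_less_iff)
    then have h: "0 < h" "h < \<delta>" "real N * h = T - t"
      using \<open>(T - t) / \<delta> < real N\<close> \<open>t < T\<close> \<open>0 < \<delta>\<close> by (auto simp: h_def field_simps)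
    define g where "g = grid t T N"
    define X where "X = noisy_chain (euler_map b t T N) c (\<lambda>i. w (g (Suc i)) - w (g i)) y"
    define E where "E k = \<bar>Y (g k) - X k\<bar>" for k
    have "E (Suc k) \<le> (1 + h * A) * E k + h * \<eta>" if "k < N" for k
    proof -
      have gS: "g (Suc k) = g k + h" using grid_Suc[OF that] by (simp add: g_def h_def)
      have g: "g k \<in> {t..T}" "g (Suc k) \<in> {t..T}" using grid_mem[OF \<open>t < T\<close>] by (auto simp: g_def)
      have intB: "B integrable_on {t..g (Suc k)}"
        using g by (intro integrable_continuous_interval continuous_on_subset[OF contB]) auto
      have sub: "B integrable_on {g k..g (Suc k)}"
        using g by (intro integrable_continuous_interval continuous_on_subset[OF contB]) auto
      have "integral {t..g k} B + integral {g k..g (Suc k)} B = integral {t..g (Suc k)} B"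
        using g gS h intB by (intro Henstock_Kurzweil_Integration.integral_combine) auto
      then have Ystep: "Y (g (Suc k)) = Y (g k) + integral {g k..g (Suc k)} B + c * (w (g (Suc k)) - w (g k))"
        using eqB[OF g(1)] eqB[OF g(2)] by (simp add: algebra_simps)
      have "integral {g k..g (Suc k)} B - h * B (g k) = integral {g k..g (Suc k)} (\<lambda>r. B r - B (g k))"
        using sub gS h by (subst Henstock_Kurzweil_Integration.integral_diff) auto
      also have "\<bar>\<dots>\<bar> \<le> \<eta> * (g (Suc k) - g k)"
      proof -
        have "norm (integral {g k..g (Suc k)} (\<lambda>r. B r - B (g k))) \<le> \<eta> * (g (Suc k) - g k)"
        proof (rule integral_bound)
          show "continuous_on {g k..g (Suc k)} (\<lambda>r. B r - B (g k))"
            using g by (intro continuous_intros continuous_on_subset[OF contB]) auto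
          fix r assume "r \<in> {g k..g (Suc k)}"
          then show "norm (B r - B (g k)) \<le> \<eta>"
            using \<delta>[of "g k" r] g gS h by (auto simp: dist_real_def less_imp_le)
        qed (use gS h in auto)
        then show ?thesis by simp
      qed
      finally have local: "\<bar>integral {g k..g (Suc k)} B - h * B (g k)\<bar> \<le> h * \<eta>"
        using gS by (simp add: mult.commute)
      have Xstep: "X (Suc k) = X k + h * b (X k) (g k) + c * (w (g (Suc k)) - w (g k))"
        by (simp add: X_def euler_map_def h_def g_def)
      have "Y (g (Suc k)) - X (Suc k) = (Y (g k) - X k) + h * (b (Y (g k)) (g k) - b (X k) (g k))
          + (integral {g k..g (Suc k)} B - h * B (g k))"
        unfolding Ystep Xstep by (simp add: B_def algebra_simps)
      then have "E (Suc k) \<le> E k + \<bar>h * (b (Y (g k)) (g k) - b (X k) (g k))\<bar> + h * \<eta>"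
        using local unfolding E_def by linarith
      also have "\<bar>h * (b (Y (g k)) (g k) - b (X k) (g k))\<bar> \<le> h * (A * E k)"
        using lip[of "g k" "Y (g k)" "X k"] g h by (simp add: abs_mult E_def)
      finally show ?thesis by (simp add: algebra_simps)
    qed
    then have "E N \<le> exp (real N * (h * A)) * (E 0 + real N * (h * \<eta>))"
      using h \<open>0 \<le> A\<close> \<open>0 < \<eta>\<close> by (intro discrete_gronwall[where N = N]) (auto simp: E_def)
    also have "E 0 = 0" using eq[of t] \<open>t < T\<close> by (simp add: E_def g_def X_def)
    also have "exp (real N * (h * A)) * (0 + real N * (h * \<eta>)) = C * \<eta>"
      using h(3) by (simp add: C_def mult.assoc[symmetric])
    also have "\<dots> < e" using \<open>0 < C\<close> \<open>0 < e\<close> by (simp add: \<eta>_def)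
    finally show "norm (noisy_chain (euler_map b t T N) c
        (\<lambda>i. w (grid t T N (Suc i)) - w (grid t T N i)) y N - Y T) < e"
      using \<open>0 < N\<close> by (simp add: E_def X_def g_def abs_minus_commute)
  qed
qed

text \<open>
  The additional drift m makes the noiseless scheme run along the straight line p from y to z.
  By Gronwall's inequality the noise moves the endpoint by at most a constant times the
  supremum of w - w(t), uniformly in the number of steps.
\<close>

lemma steered_chain_near_target:
  fixes b :: "real \<Rightarrow> real \<Rightarrow> real" and w :: "real \<Rightarrow> real"
  assumes "t < T" "0 \<le> A" "0 \<le> c" "0 < N"
    and lip: "\<And>u v s. s \<le> T \<Longrightarrow> \<bar>b u s - b v s\<bar> \<le> A * \<bar>u - v\<bar>"
    and w: "\<And>k. k \<le> N \<Longrightarrow> \<bar>w (grid t T N k) - w t\<bar> \<le> K"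
    and p: "\<And>s. p s = y + (s - t) * ((z - y) / (T - t))"
    and m: "\<And>k. m k = (T - t) / real N * ((z - y) / (T - t) - b (p (grid t T N k)) (grid t T N k))"
  shows "\<bar>noisy_chain (\<lambda>k v. euler_map b t T N k v + m k) c
      (\<lambda>i. w (grid t T N (Suc i)) - w (grid t T N i)) y N - z\<bar>
    \<le> (exp ((T - t) * A) * ((T - t) * A) + 1) * (c * K)"
proof -
  define h where "h = (T - t) / real N"
  have h: "0 < h" "real N * h = T - t"
    using \<open>t < T\<close> \<open>0 < N\<close> by (auto simp: h_def)
  define g where "g = grid t T N"
  define X where "X = noisy_chain (\<lambda>k v. euler_map b t T N k v + m k) c (\<lambda>i. w (g (Suc i)) - w (g i)) y"
  define E where "E k = \<bar>X k - p (g k) - c * (w (g k) - w t)\<bar>" for k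
  have "0 \<le> K" using w[of 0] by simp
  have cw: "\<bar>c * (w (g k) - w t)\<bar> \<le> c * K" if "k \<le> N" for k
    using mult_left_mono[OF w[OF that] \<open>0 \<le> c\<close>] \<open>0 \<le> c\<close> by (simp add: abs_mult g_def)
  have "E (Suc k) \<le> (1 + h * A) * E k + h * A * (c * K)" if "k < N" for k
  proof -
    have gS: "g (Suc k) = g k + h" using grid_Suc[OF that] by (simp add: g_def h_def)
    have g: "g k \<le> T" using grid_mem[OF \<open>t < T\<close>, of N k] by (simp add: g_def)
    have pS: "p (g (Suc k)) = p (g k) + h * ((z - y) / (T - t))"
      unfolding p gS by algebra
    have Xstep: "X (Suc k) = X k + h * b (X k) (g k)
        + h * ((z - y) / (T - t) - b (p (g k)) (g k)) + c * (w (g (Suc k)) - w (g k))"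
      by (simp add: X_def euler_map_def h_def g_def m)
    have "X (Suc k) - p (g (Suc k)) - c * (w (g (Suc k)) - w t)
        = (X k - p (g k) - c * (w (g k) - w t)) + h * (b (X k) (g k) - b (p (g k)) (g k))"
      unfolding Xstep pS by algebra
    then have "E (Suc k) \<le> E k + \<bar>h * (b (X k) (g k) - b (p (g k)) (g k))\<bar>"
      unfolding E_def by linarith
    also have "\<bar>h * (b (X k) (g k) - b (p (g k)) (g k))\<bar> \<le> h * (A * \<bar>X k - p (g k)\<bar>)"
      using lip[OF g, of "X k" "p (g k)"] h by (simp add: abs_mult)
    also have "\<dots> \<le> h * (A * (E k + c * K))"
    proof -
      have "\<bar>X k - p (g k)\<bar> \<le> E k + c * K" using cw[of k] that unfolding E_def by linarith
      then show ?thesis using h \<open>0 \<le> A\<close> by (intro mult_left_mono) auto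
    qed
    finally show ?thesis by (simp add: algebra_simps)
  qed
  then have "E N \<le> exp (real N * (h * A)) * (E 0 + real N * (h * A * (c * K)))"
    using h \<open>0 \<le> A\<close> \<open>0 \<le> c\<close> \<open>0 \<le> K\<close> by (intro discrete_gronwall[where N = N]) (auto simp: E_def)
  also have "E 0 = 0" by (simp add: E_def g_def X_def p)
  also have "exp (real N * (h * A)) * (0 + real N * (h * A * (c * K))) = exp ((T - t) * A) * ((T - t) * A) * (c * K)"
    using h(2) by (simp add: mult.assoc[symmetric])
  finally have "E N \<le> exp ((T - t) * A) * ((T - t) * A) * (c * K)" .
  moreover have "p (g N) = z" using \<open>0 < N\<close> \<open>t < T\<close> by (simp add: g_def p)
  ultimately have "\<bar>X N - z\<bar> \<le> exp ((T - t) * A) * ((T - t) * A) * (c * K) + c * K"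
    using cw[of N] unfolding E_def by linarith
  then show ?thesis by (simp add: X_def g_def algebra_simps)
qed

section \<open>The limit of vanishing step size\<close>

lemma (in prob_space) prob_tendsto_zero:
  assumes [measurable]: "\<And>n. S n \<in> events"
    and ev: "AE \<omega> in M. eventually (\<lambda>n. \<omega> \<notin> S n) sequentially"
  shows "(\<lambda>n. prob (S n)) \<longlonglongrightarrow> 0"
proof -
  have "(\<lambda>n. expectation (indicator (S n) :: 'a \<Rightarrow> real)) \<longlonglongrightarrow> expectation (\<lambda>_. 0 :: real)"
  proof (rule integral_dominated_convergence[where w = "\<lambda>_. 1"])
    show "AE \<omega> in M. (\<lambda>n. indicator (S n) \<omega> :: real) \<longlonglongrightarrow> 0"
      using ev
    proof eventually_elim
      case (elim \<omega>)
      then have "eventually (\<lambda>n. indicator (S n) \<omega> = (0 :: real)) sequentially"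
        by eventually_elim simp
      then show ?case by (rule tendsto_eventually)
    qed
  qed (auto simp: indicator_def)
  then show ?thesis by simp
qed

text \<open>
  The start time t is fixed, while start points and solutions vary. A Lipschitz bound on b replaces the
  bound on its derivative.
\<close>

locale concave_sde =
  fixes M :: "'w measure" and W :: "real \<Rightarrow> 'w \<Rightarrow> real"
    and b :: "real \<Rightarrow> real \<Rightarrow> real" and A T t \<epsilon> :: real
  assumes bm: "brownian_motion M {..T} W"
    and t_less: "t < T" and A_nonneg: "0 \<le> A" and eps_pos: "0 < \<epsilon>"
    and b_cont: "continuous_on (UNIV \<times> {..T}) (\<lambda>(y, t). b y t)"
    and lip: "\<And>u v s. s \<le> T \<Longrightarrow> \<bar>b u s - b v s\<bar> \<le> A * \<bar>u - v\<bar>"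
    and conc: "\<And>s. s \<le> T \<Longrightarrow> concave_on UNIV (\<lambda>y. b y s)"

sublocale concave_sde \<subseteq> prob_space M
  using bm by (simp add: brownian_motion_def)

context concave_sde
begin

definition mesh :: "nat \<Rightarrow> real" where
  "mesh N = (T - t) / real N"

definition noise :: "nat \<Rightarrow> nat \<Rightarrow> 'w \<Rightarrow> real" where
  "noise N i \<omega> = W (grid t T N (Suc i)) \<omega> - W (grid t T N i) \<omega>"

definition euler :: "nat \<Rightarrow> real \<Rightarrow> 'w \<Rightarrow> real" where
  "euler N y \<omega> = noisy_chain (euler_map b t T N) (sqrt \<epsilon>) (\<lambda>i. noise N i \<omega>) y N"

lemma mesh_pos: "0 < N \<Longrightarrow> 0 < mesh N"
  using t_less by (simp add: mesh_def)

lemma grid_le_T: "grid t T N k \<in> {..T}"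
  using grid_mem[OF t_less, of N k] by simp

lemma W_measurable [measurable]: "W (grid t T N k) \<in> borel_measurable M" "W t \<in> borel_measurable M"
  using bm grid_le_T t_less by (auto simp: brownian_motion_def)

lemma noise_measurable [measurable]: "noise N i \<in> borel_measurable M"
  unfolding noise_def[abs_def] by (intro borel_measurable_diff W_measurable)

lemma noise_indep: "indep_vars (\<lambda>_. borel) (noise N) {..<N}"
proof -
  have "\<forall>i<N. grid t T N i < grid t T N (Suc i)"
    using t_less by (auto simp: grid_Suc)
  then show ?thesis
    using bm grid_le_T unfolding brownian_motion_def noise_def[abs_def] by blast
qed

lemma noise_distributed:
  assumes "k < N"
  shows "distributed M lborel (noise N k) (normal_density 0 (sqrt (mesh N)))"
proof -
  have "grid t T N k < grid t T N (Suc k)" "grid t T N (Suc k) - grid t T N k = mesh N"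
    using assms t_less by (auto simp: grid_Suc mesh_def)
  then show ?thesis
    using bm grid_le_T unfolding brownian_motion_def noise_def[abs_def] by metis
qed

lemma euler_measurable [measurable]: "euler N y \<in> borel_measurable M"
proof -
  have "euler_map b t T N k \<in> borel_measurable borel" for k
  proof -
    have "continuous_on UNIV (\<lambda>y. (\<lambda>(y, t). b y t) (y, grid t T N k))"
      by (rule continuous_on_compose2[OF b_cont]) (use grid_le_T in \<open>auto intro!: continuous_intros\<close>)
    then have [measurable]: "(\<lambda>y. b y (grid t T N k)) \<in> borel_measurable borel"
      by (intro borel_measurable_continuous_onI) simp
    show ?thesis unfolding euler_map_def by measurable
  qed
  then show ?thesis
    unfolding euler_def[abs_def] by (intro noisy_chain_measurable) simp_all
qed

lemma mesh_tendsto: "mesh \<longlonglongrightarrow> 0"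
  unfolding mesh_def[abs_def] by (rule lim_const_over_n)

lemma eventually_fine_mesh: "eventually (\<lambda>N. 0 < N \<and> mesh N * A \<le> 1) sequentially"
proof -
  have "(\<lambda>N. mesh N * A) \<longlonglongrightarrow> 0 * A"
    by (intro tendsto_intros mesh_tendsto)
  then have "eventually (\<lambda>N. mesh N * A < 1) sequentially"
    by (rule order_tendstoD) simp
  then show ?thesis
    using eventually_gt_at_top[of 0] by eventually_elim auto
qed

lemma mono_fine_euler_map: "mesh N * A \<le> 1 \<Longrightarrow> mono (euler_map b t T N k)"
  using mono_euler_map[OF lip t_less] by (simp add: mesh_def)

lemma prob_euler:
  assumes "0 < N" "mesh N * A \<le> 1"
  shows "prob {\<omega> \<in> space M. x < euler N y \<omega>}
    = chain_tail (euler_map b t T N) (sqrt \<epsilon>) (sqrt (mesh N)) N 0 x y"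
  unfolding euler_def
  using assms by (intro prob_noisy_chain mono_fine_euler_map noise_indep noise_distributed) (auto simp: mesh_pos)

lemma euler_tail_log_concave:
  assumes "0 < N" "mesh N * A \<le> 1"
  shows "log_concave (\<lambda>(x, y). prob {\<omega> \<in> space M. x < euler N y \<omega>})"
  unfolding prob_euler[OF assms]
  using assms concave_euler_map[OF conc t_less]
  by (intro log_concave_chain_tail mono_fine_euler_map) (auto simp: mesh_pos)

lemma euler_tendsto:
  assumes "sde_solution M W b \<epsilon> T t y Y"
  shows "AE \<omega> in M. (\<lambda>N. euler N y \<omega>) \<longlonglongrightarrow> Y T \<omega>"
proof -
  have "AE \<omega> in M. continuous_on {t..T} (\<lambda>s. Y s \<omega>) \<and>
        (\<forall>s\<in>{t..T}. Y s \<omega> = y + integral {t..s} (\<lambda>r. b (Y r \<omega>) r)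
                              + sqrt \<epsilon> * (W s \<omega> - W t \<omega>))"
    using assms by (simp add: sde_solution_def)
  then show ?thesis
  proof eventually_elim
    case (elim \<omega>)
    then show ?case
      unfolding euler_def noise_def
      by (intro euler_converges[OF t_less A_nonneg b_cont lip, where w = "\<lambda>s. W s \<omega>"]) auto
  qed
qed

lemma solution_measurable:
  "sde_solution M W b \<epsilon> T t y Y \<Longrightarrow> Y T \<in> borel_measurable M"
  using t_less by (simp add: sde_solution_def)

text \<open>
  One constant K serves all grids at once, because it bounds the whole path on [t, T].
\<close>

lemma brownian_bounded_prob:
  "\<exists>K::nat. 1 / 2 \<le> prob {\<omega> \<in> space M. \<forall>N k. \<bar>W (grid t T N k) \<omega> - W t \<omega>\<bar> \<le> real K}"
proof -
  let ?S = "\<lambda>K::nat. {\<omega> \<in> space M. \<exists>N k. real K < \<bar>W (grid t T N k) \<omega> - W t \<omega>\<bar>}"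
  have "(\<lambda>K. prob (?S K)) \<longlonglongrightarrow> 0"
  proof (rule prob_tendsto_zero)
    have "AE \<omega> in M. continuous_on {..T} (\<lambda>s. W s \<omega>)"
      using bm by (simp add: brownian_motion_def)
    then show "AE \<omega> in M. eventually (\<lambda>K. \<omega> \<notin> ?S K) sequentially"
    proof eventually_elim
      case (elim \<omega>)
      then have "continuous_on {t..T} (\<lambda>s. W s \<omega> - W t \<omega>)"
        by (intro continuous_intros continuous_on_subset[OF elim]) auto
      then have "bounded ((\<lambda>s. W s \<omega> - W t \<omega>) ` {t..T})"
        by (intro compact_imp_bounded compact_continuous_image) auto
      then obtain B where "\<forall>x\<in>(\<lambda>s. W s \<omega> - W t \<omega>) ` {t..T}. norm x \<le> B"
        unfolding bounded_iff by blast
      then have B: "\<bar>W s \<omega> - W t \<omega>\<bar> \<le> B" if "s \<in> {t..T}" for s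
        using that by auto
      have "\<omega> \<notin> ?S K" if "nat \<lceil>B\<rceil> \<le> K" for K
      proof -
        have "B \<le> real K" using that by linarith
        then have "\<bar>W (grid t T N k) \<omega> - W t \<omega>\<bar> \<le> real K" for N k
          using B[OF grid_mem[OF t_less, of N k]] by linarith
        then have "\<not> (\<exists>N k. real K < \<bar>W (grid t T N k) \<omega> - W t \<omega>\<bar>)"
          by (simp add: not_less)
        then show ?thesis by blast
      qed
      then show ?case by (rule eventually_sequentiallyI)
    qed
  qed measurable
  then have "eventually (\<lambda>K. prob (?S K) < 1 / 2) sequentially"
    by (rule order_tendstoD) simp
  then obtain K where K: "prob (?S K) < 1 / 2"
    by (auto simp: eventually_sequentially)
  have "{\<omega> \<in> space M. \<forall>N k. \<bar>W (grid t T N k) \<omega> - W t \<omega>\<bar> \<le> real K} = space M - ?S K"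
    unfolding not_le[symmetric] by blast
  then show ?thesis
    using K by (intro exI[of _ K]) (simp add: prob_compl)
qed

text \<open>
  Positivity that survives the limit needs a bound uniform in the number of steps. Steering the scheme by
  an additional drift to a target z far above x makes it end above x whenever the Brownian path
  is bounded by K, hence with probability at least 1/2. Removing the drift costs a square and an
  exponential factor, whose exponent is minus the sum over the steps of (h \<mu>)^2 / (\<epsilon> h).
  This sum equals (T - t) \<mu>^2 / \<epsilon> for every N.
\<close>

lemma euler_tail_bounded_below:
  "\<exists>\<delta>>0. eventually (\<lambda>N. \<delta> \<le> prob {\<omega> \<in> space M. x < euler N y \<omega>}) sequentially"
proof -
  obtain K :: nat where
    K: "1 / 2 \<le> prob {\<omega> \<in> space M. \<forall>N k. \<bar>W (grid t T N k) \<omega> - W t \<omega>\<bar> \<le> real K}"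
    using brownian_bounded_prob by blast
  define C where "C = (exp ((T - t) * A) * ((T - t) * A) + 1) * (sqrt \<epsilon> * real K)"
  define z where "z = x + 1 + C"
  define p where "p s = y + (s - t) * ((z - y) / (T - t))" for s
  have "continuous_on {t..T} (\<lambda>s. (z - y) / (T - t) - b (p s) s)"
    by (intro continuous_intros continuous_on_along_path[OF b_cont])
      (use t_less in \<open>auto simp: p_def[abs_def] intro!: continuous_intros\<close>)
  then have "bounded ((\<lambda>s. (z - y) / (T - t) - b (p s) s) ` {t..T})"
    by (intro compact_imp_bounded compact_continuous_image) auto
  then obtain \<mu> where "\<forall>x\<in>(\<lambda>s. (z - y) / (T - t) - b (p s) s) ` {t..T}. norm x \<le> \<mu>"
    unfolding bounded_iff by blast
  then have \<mu>: "\<bar>(z - y) / (T - t) - b (p s) s\<bar> \<le> \<mu>" if "s \<in> {t..T}" for s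
    using that by auto
  define \<delta> where "\<delta> = exp (- ((T - t) * \<mu>\<^sup>2 / \<epsilon>)) * (1 / 2)\<^sup>2"
  have "eventually (\<lambda>N. \<delta> \<le> prob {\<omega> \<in> space M. x < euler N y \<omega>}) sequentially"
    using eventually_fine_mesh
  proof eventually_elim
    case (elim N)
    let ?h = "mesh N"
    have h: "0 < ?h" using elim by (simp add: mesh_pos)
    define m where "m k = ?h * ((z - y) / (T - t) - b (p (grid t T N k)) (grid t T N k))" for k
    let ?\<phi> = "\<lambda>k v. euler_map b t T N k v + m k"
    have m: "\<bar>m k\<bar> \<le> ?h * \<mu>" for k
      using \<mu>[OF grid_mem[OF t_less]] h by (simp add: m_def abs_mult)
    have mono: "mono (?\<phi> k)" for k
      using monoD[OF mono_fine_euler_map] elim by (intro monoI add_right_mono) auto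
    have [measurable]: "(\<lambda>\<omega>. noisy_chain ?\<phi> (sqrt \<epsilon>) (\<lambda>i. noise N i \<omega>) y N) \<in> borel_measurable M"
      by (intro noisy_chain_measurable borel_measurable_mono mono) simp
    have "1 / 2 \<le> prob {\<omega> \<in> space M. x < noisy_chain ?\<phi> (sqrt \<epsilon>) (\<lambda>i. noise N i \<omega>) y N}"
    proof (rule order_trans[OF K finite_measure_mono])
      show "{\<omega> \<in> space M. \<forall>N k. \<bar>W (grid t T N k) \<omega> - W t \<omega>\<bar> \<le> real K}
          \<subseteq> {\<omega> \<in> space M. x < noisy_chain ?\<phi> (sqrt \<epsilon>) (\<lambda>i. noise N i \<omega>) y N}"
      proof safe
        fix \<omega> assume W: "\<forall>N k. \<bar>W (grid t T N k) \<omega> - W t \<omega>\<bar> \<le> real K"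
        have "\<bar>noisy_chain ?\<phi> (sqrt \<epsilon>) (\<lambda>i. noise N i \<omega>) y N - z\<bar> \<le> C"
          unfolding C_def noise_def
          by (rule steered_chain_near_target[OF t_less A_nonneg, where p = p and w = "\<lambda>s. W s \<omega>"])
            (use W elim eps_pos lip in \<open>auto simp: p_def m_def mesh_def\<close>)
        then show "x < noisy_chain ?\<phi> (sqrt \<epsilon>) (\<lambda>i. noise N i \<omega>) y N"
          unfolding z_def by linarith
      qed
    qed measurable
    also have "\<dots> = chain_tail ?\<phi> (sqrt \<epsilon>) (sqrt ?h) N 0 x y"
      using h by (intro prob_noisy_chain mono noise_indep noise_distributed) auto
    finally have "(1 / 2)\<^sup>2 \<le> (chain_tail ?\<phi> (sqrt \<epsilon>) (sqrt ?h) N 0 x y)\<^sup>2"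
      by (intro power_mono) auto
    moreover have "real N * (?h * \<mu> / (sqrt \<epsilon> * sqrt ?h))\<^sup>2 = (T - t) * \<mu>\<^sup>2 / \<epsilon>"
    proof -
      have "real N * (?h * \<mu> / (sqrt \<epsilon> * sqrt ?h))\<^sup>2 = real N * ?h * \<mu>\<^sup>2 / \<epsilon>"
        using h eps_pos by (simp add: power_divide power_mult_distrib power2_eq_square[of ?h])
      also have "real N * ?h = T - t" using elim by (simp add: mesh_def)
      finally show ?thesis .
    qed
    ultimately have "\<delta> \<le> exp (- (real N * (?h * \<mu> / (sqrt \<epsilon> * sqrt ?h))\<^sup>2))
        * (chain_tail ?\<phi> (sqrt \<epsilon>) (sqrt ?h) N 0 x y)\<^sup>2"
      by (simp add: \<delta>_def)
    also have "\<dots> \<le> chain_tail (euler_map b t T N) (sqrt \<epsilon>) (sqrt ?h) N 0 x y"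
      using m h elim eps_pos by (intro chain_tail_shifted_drift mono_fine_euler_map) auto
    also have "\<dots> = prob {\<omega> \<in> space M. x < euler N y \<omega>}"
      using elim by (simp add: prob_euler)
    finally show ?case .
  qed
  moreover have "0 < \<delta>" by (simp add: \<delta>_def)
  ultimately show ?thesis by blast
qed

text \<open>
  Almost sure convergence transfers strict exceedance to the scheme, but the scheme's exceedance only
  gives the weak inequality in the limit. The two error terms vanish.
\<close>

lemma prob_missed_exceedance_tendsto:
  assumes "sde_solution M W b \<epsilon> T t y Y"
  shows "(\<lambda>N. prob {\<omega> \<in> space M. x < Y T \<omega> \<and> euler N y \<omega> \<le> x}) \<longlonglongrightarrow> 0"
proof (rule prob_tendsto_zero)
  have [measurable]: "Y T \<in> borel_measurable M" by (rule solution_measurable[OF assms])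
  show "{\<omega> \<in> space M. x < Y T \<omega> \<and> euler N y \<omega> \<le> x} \<in> events" for N by measurable
  show "AE \<omega> in M. eventually (\<lambda>N. \<omega> \<notin> {\<omega> \<in> space M. x < Y T \<omega> \<and> euler N y \<omega> \<le> x}) sequentially"
    using euler_tendsto[OF assms]
  proof eventually_elim
    case (elim \<omega>)
    show ?case
    proof (cases "x < Y T \<omega>")
      case True
      from order_tendstoD(1)[OF elim this] show ?thesis by eventually_elim auto
    qed simp
  qed
qed

lemma prob_spurious_exceedance_tendsto:
  assumes "sde_solution M W b \<epsilon> T t y Y"
  shows "(\<lambda>N. prob {\<omega> \<in> space M. Y T \<omega> < x \<and> x < euler N y \<omega>}) \<longlonglongrightarrow> 0"
proof (rule prob_tendsto_zero)
  have [measurable]: "Y T \<in> borel_measurable M" by (rule solution_measurable[OF assms])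
  show "{\<omega> \<in> space M. Y T \<omega> < x \<and> x < euler N y \<omega>} \<in> events" for N by measurable
  show "AE \<omega> in M. eventually (\<lambda>N. \<omega> \<notin> {\<omega> \<in> space M. Y T \<omega> < x \<and> x < euler N y \<omega>}) sequentially"
    using euler_tendsto[OF assms]
  proof eventually_elim
    case (elim \<omega>)
    show ?case
    proof (cases "Y T \<omega> < x")
      case True
      from order_tendstoD(2)[OF elim this] show ?thesis by eventually_elim auto
    qed simp
  qed
qed

lemma prob_euler_le:
  assumes "sde_solution M W b \<epsilon> T t y Y"
  shows "prob {\<omega> \<in> space M. x < euler N y \<omega>}
    \<le> prob {\<omega> \<in> space M. x \<le> Y T \<omega>} + prob {\<omega> \<in> space M. Y T \<omega> < x \<and> x < euler N y \<omega>}"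
proof -
  have [measurable]: "Y T \<in> borel_measurable M" by (rule solution_measurable[OF assms])
  have "prob {\<omega> \<in> space M. x < euler N y \<omega>}
      \<le> prob ({\<omega> \<in> space M. x \<le> Y T \<omega>} \<union> {\<omega> \<in> space M. Y T \<omega> < x \<and> x < euler N y \<omega>})"
    by (intro finite_measure_mono) auto
  also have "\<dots> \<le> prob {\<omega> \<in> space M. x \<le> Y T \<omega>} + prob {\<omega> \<in> space M. Y T \<omega> < x \<and> x < euler N y \<omega>}"
    by (intro measure_Un_le) measurable
  finally show ?thesis .
qed

lemma prob_le_euler:
  assumes "sde_solution M W b \<epsilon> T t y Y"
  shows "prob {\<omega> \<in> space M. x < Y T \<omega>}
    \<le> prob {\<omega> \<in> space M. x < euler N y \<omega>} + prob {\<omega> \<in> space M. x < Y T \<omega> \<and> euler N y \<omega> \<le> x}"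
proof -
  have [measurable]: "Y T \<in> borel_measurable M" by (rule solution_measurable[OF assms])
  have "prob {\<omega> \<in> space M. x < Y T \<omega>}
      \<le> prob ({\<omega> \<in> space M. x < euler N y \<omega>} \<union> {\<omega> \<in> space M. x < Y T \<omega> \<and> euler N y \<omega> \<le> x})"
    by (intro finite_measure_mono) auto
  also have "\<dots> \<le> prob {\<omega> \<in> space M. x < euler N y \<omega>} + prob {\<omega> \<in> space M. x < Y T \<omega> \<and> euler N y \<omega> \<le> x}"
    by (intro measure_Un_le) measurable
  finally show ?thesis .
qed

lemma tail_pos:
  assumes "sde_solution M W b \<epsilon> T t y Y"
  shows "0 < prob {\<omega> \<in> space M. x < Y T \<omega>}"
proof -
  have [measurable]: "Y T \<in> borel_measurable M" by (rule solution_measurable[OF assms])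
  obtain \<delta> where "0 < \<delta>"
    and \<delta>: "eventually (\<lambda>N. \<delta> \<le> prob {\<omega> \<in> space M. x + 1 < euler N y \<omega>}) sequentially"
    using euler_tail_bounded_below by blast
  have "\<delta> \<le> prob {\<omega> \<in> space M. x + 1 \<le> Y T \<omega>} + 0"
  proof (rule tendsto_le[OF sequentially_bot])
    show "(\<lambda>N. prob {\<omega> \<in> space M. x + 1 \<le> Y T \<omega>}
        + prob {\<omega> \<in> space M. Y T \<omega> < x + 1 \<and> x + 1 < euler N y \<omega>})
        \<longlonglongrightarrow> prob {\<omega> \<in> space M. x + 1 \<le> Y T \<omega>} + 0"
      by (intro tendsto_intros prob_spurious_exceedance_tendsto[OF assms])
    show "eventually (\<lambda>N. \<delta> \<le> prob {\<omega> \<in> space M. x + 1 \<le> Y T \<omega>}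
        + prob {\<omega> \<in> space M. Y T \<omega> < x + 1 \<and> x + 1 < euler N y \<omega>}) sequentially"
      using \<delta>
    proof eventually_elim
      case (elim N)
      then show ?case using prob_euler_le[OF assms, of "x + 1" N] by linarith
    qed
  qed simp
  also have "prob {\<omega> \<in> space M. x + 1 \<le> Y T \<omega>} + 0 \<le> prob {\<omega> \<in> space M. x < Y T \<omega>}"
    by (auto intro!: finite_measure_mono)
  finally show ?thesis using \<open>0 < \<delta>\<close> by linarith
qed

text \<open>
  The limit of the corresponding inequality for the Euler scheme. The right-hand side is the
  probability of a closed half-line, since convergence of the scheme alone does not exclude that
  mass accumulates at the threshold.
\<close>

lemma tail_log_concave_closed:
  assumes sol: "sde_solution M W b \<epsilon> T t y0 Y0" "sde_solution M W b \<epsilon> T t y1 Y1"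
    "sde_solution M W b \<epsilon> T t ((1 - l) * y0 + l * y1) Y"
    and l: "0 < l" "l < 1"
  shows "prob {\<omega> \<in> space M. x0 < Y0 T \<omega>} powr (1 - l) * prob {\<omega> \<in> space M. x1 < Y1 T \<omega>} powr l
    \<le> prob {\<omega> \<in> space M. (1 - l) * x0 + l * x1 \<le> Y T \<omega>}"
proof -
  define x where "x = (1 - l) * x0 + l * x1"
  define y where "y = (1 - l) * y0 + l * y1"
  define p0 where "p0 = prob {\<omega> \<in> space M. x0 < Y0 T \<omega>}"
  define p1 where "p1 = prob {\<omega> \<in> space M. x1 < Y1 T \<omega>}"
  define r0 where "r0 N = prob {\<omega> \<in> space M. x0 < Y0 T \<omega> \<and> euler N y0 \<omega> \<le> x0}" for N
  define r1 where "r1 N = prob {\<omega> \<in> space M. x1 < Y1 T \<omega> \<and> euler N y1 \<omega> \<le> x1}" for N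
  define r where "r N = prob {\<omega> \<in> space M. Y T \<omega> < x \<and> x < euler N y \<omega>}" for N
  have pos: "0 < p0" "0 < p1"
    unfolding p0_def p1_def using tail_pos sol by blast+
  have lims: "r0 \<longlonglongrightarrow> 0" "r1 \<longlonglongrightarrow> 0" "r \<longlonglongrightarrow> 0"
    unfolding r0_def[abs_def] r1_def[abs_def] r_def[abs_def] y_def
    using sol by (auto intro: prob_missed_exceedance_tendsto prob_spurious_exceedance_tendsto)
  have "p0 powr (1 - l) * p1 powr l \<le> prob {\<omega> \<in> space M. x \<le> Y T \<omega>}"
  proof (rule tendsto_le[OF sequentially_bot])
    show "(\<lambda>N. prob {\<omega> \<in> space M. x \<le> Y T \<omega>} + r N) \<longlonglongrightarrow> prob {\<omega> \<in> space M. x \<le> Y T \<omega>}"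
      using tendsto_add[OF tendsto_const lims(3)] by simp
    \<comment> \<open>The truncation at 0 keeps \<open>powr\<close> monotone on the lower bounds.\<close>
    have "(\<lambda>N. max 0 (p0 - r0 N)) \<longlonglongrightarrow> max 0 (p0 - 0)" "(\<lambda>N. max 0 (p1 - r1 N)) \<longlonglongrightarrow> max 0 (p1 - 0)"
      using lims by (intro tendsto_max tendsto_diff tendsto_const; simp)+
    then show "(\<lambda>N. max 0 (p0 - r0 N) powr (1 - l) * max 0 (p1 - r1 N) powr l) \<longlonglongrightarrow> p0 powr (1 - l) * p1 powr l"
      using pos by (intro tendsto_mult tendsto_powr tendsto_const) auto
    show "eventually (\<lambda>N. max 0 (p0 - r0 N) powr (1 - l) * max 0 (p1 - r1 N) powr l
        \<le> prob {\<omega> \<in> space M. x \<le> Y T \<omega>} + r N) sequentially"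
      using eventually_fine_mesh
    proof eventually_elim
      case (elim N)
      have "max 0 (p0 - r0 N) \<le> prob {\<omega> \<in> space M. x0 < euler N y0 \<omega>}"
        using prob_le_euler[OF sol(1), of x0 N] by (simp add: p0_def r0_def)
      moreover have "max 0 (p1 - r1 N) \<le> prob {\<omega> \<in> space M. x1 < euler N y1 \<omega>}"
        using prob_le_euler[OF sol(2), of x1 N] by (simp add: p1_def r1_def)
      ultimately have "max 0 (p0 - r0 N) powr (1 - l) * max 0 (p1 - r1 N) powr l
          \<le> prob {\<omega> \<in> space M. x0 < euler N y0 \<omega>} powr (1 - l) * prob {\<omega> \<in> space M. x1 < euler N y1 \<omega>} powr l"
        using l by (intro mult_mono powr_mono2) auto
      also have "\<dots> \<le> prob {\<omega> \<in> space M. x < euler N y \<omega>}"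
        using log_concaveD[OF euler_tail_log_concave l, of N "(x0, y0)" "(x1, y1)"] elim
        by (simp add: x_def y_def)
      also have "\<dots> \<le> prob {\<omega> \<in> space M. x \<le> Y T \<omega>} + r N"
        using prob_euler_le[OF sol(3), of x N] by (simp add: r_def y_def)
      finally show ?case .
    qed
  qed
  then show ?thesis by (simp add: x_def p0_def p1_def)
qed

lemma tail_right_continuous:
  assumes [measurable]: "Z \<in> borel_measurable M"
  shows "(\<lambda>n. prob {\<omega> \<in> space M. x + 1 / real (Suc n) < Z \<omega>}) \<longlonglongrightarrow> prob {\<omega> \<in> space M. x < Z \<omega>}"
proof -
  let ?S = "\<lambda>n. {\<omega> \<in> space M. x < Z \<omega> \<and> Z \<omega> \<le> x + 1 / real (Suc n)}"
  have "(\<lambda>n. prob (?S n)) \<longlonglongrightarrow> 0"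
  proof (rule prob_tendsto_zero)
    have "eventually (\<lambda>n. \<omega> \<notin> ?S n) sequentially" for \<omega>
    proof (cases "x < Z \<omega>")
      case True
      have "(\<lambda>n. x + 1 / real (Suc n)) \<longlonglongrightarrow> x + 0"
        by (intro tendsto_intros LIMSEQ_Suc[OF lim_const_over_n])
      then have "eventually (\<lambda>n. x + 1 / real (Suc n) < Z \<omega>) sequentially"
        using True by (intro order_tendstoD(2)) auto
      then show ?thesis by eventually_elim auto
    qed simp
    then show "AE \<omega> in M. eventually (\<lambda>n. \<omega> \<notin> ?S n) sequentially" by simp
  qed measurable
  then have "(\<lambda>n. prob {\<omega> \<in> space M. x < Z \<omega>} - prob (?S n)) \<longlonglongrightarrow> prob {\<omega> \<in> space M. x < Z \<omega>} - 0"
    by (intro tendsto_intros)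
  moreover have "prob {\<omega> \<in> space M. x < Z \<omega>} - prob (?S n) = prob {\<omega> \<in> space M. x + 1 / real (Suc n) < Z \<omega>}" for n
  proof -
    have "{\<omega> \<in> space M. x + 1 / real (Suc n) < Z \<omega>} = {\<omega> \<in> space M. x < Z \<omega>} - ?S n"
      by (auto simp: not_le intro: less_trans[rotated])
    then show ?thesis by (simp add: finite_measure_Diff[symmetric] subset_iff)
  qed
  ultimately show ?thesis by simp
qed

text \<open>
  Raising both thresholds by 1/(n+1) raises their convex combination by the same amount, which turns
  the closed half-line into an open one; then n tends to infinity.
\<close>

lemma tail_log_concave:
  assumes sol: "sde_solution M W b \<epsilon> T t y0 Y0" "sde_solution M W b \<epsilon> T t y1 Y1"
    "sde_solution M W b \<epsilon> T t ((1 - l) * y0 + l * y1) Y"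
    and l: "0 < l" "l < 1"
  shows "prob {\<omega> \<in> space M. x0 < Y0 T \<omega>} powr (1 - l) * prob {\<omega> \<in> space M. x1 < Y1 T \<omega>} powr l
    \<le> prob {\<omega> \<in> space M. (1 - l) * x0 + l * x1 < Y T \<omega>}"
proof (rule LIMSEQ_le_const2)
  note [measurable] = sol[THEN solution_measurable]
  show "(\<lambda>n. prob {\<omega> \<in> space M. x0 + 1 / real (Suc n) < Y0 T \<omega>} powr (1 - l)
      * prob {\<omega> \<in> space M. x1 + 1 / real (Suc n) < Y1 T \<omega>} powr l)
    \<longlonglongrightarrow> prob {\<omega> \<in> space M. x0 < Y0 T \<omega>} powr (1 - l) * prob {\<omega> \<in> space M. x1 < Y1 T \<omega>} powr l"
    using tail_pos[OF sol(1), of x0] tail_pos[OF sol(2), of x1]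
    by (intro tendsto_mult tendsto_powr tendsto_const tail_right_continuous) auto
  have "prob {\<omega> \<in> space M. x0 + 1 / real (Suc n) < Y0 T \<omega>} powr (1 - l)
      * prob {\<omega> \<in> space M. x1 + 1 / real (Suc n) < Y1 T \<omega>} powr l
      \<le> prob {\<omega> \<in> space M. (1 - l) * x0 + l * x1 < Y T \<omega>}" for n
  proof (rule order_trans[OF tail_log_concave_closed[OF sol l] finite_measure_mono])
    have "(1 - l) * (x0 + 1 / real (Suc n)) + l * (x1 + 1 / real (Suc n))
        = (1 - l) * x0 + l * x1 + 1 / real (Suc n)" by (simp only: distrib_left left_diff_distrib)
    moreover have "0 < 1 / real (Suc n)" by simp
    ultimately have "(1 - l) * x0 + l * x1 < v"
      if "(1 - l) * (x0 + 1 / real (Suc n)) + l * (x1 + 1 / real (Suc n)) \<le> v" for v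
      using that by linarith
    then show "{\<omega> \<in> space M. (1 - l) * (x0 + 1 / real (Suc n)) + l * (x1 + 1 / real (Suc n)) \<le> Y T \<omega>}
        \<subseteq> {\<omega> \<in> space M. (1 - l) * x0 + l * x1 < Y T \<omega>}"
      by blast
  qed measurable
  then show "\<exists>N. \<forall>n\<ge>N. prob {\<omega> \<in> space M. x0 + 1 / real (Suc n) < Y0 T \<omega>} powr (1 - l)
      * prob {\<omega> \<in> space M. x1 + 1 / real (Suc n) < Y1 T \<omega>} powr l
      \<le> prob {\<omega> \<in> space M. (1 - l) * x0 + l * x1 < Y T \<omega>}" by blast
qed

end

section \<open>Convexity of q\<close>

lemma lipschitz_of_deriv_bound:
  fixes f :: "real \<Rightarrow> real"
  assumes "\<And>y. f differentiable (at y)" "\<And>y. \<bar>deriv f y\<bar> \<le> A"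
  shows "\<bar>f u - f v\<bar> \<le> A * \<bar>u - v\<bar>"
proof -
  have "norm (f u - f v) \<le> A * norm (u - v)"
  proof (rule field_differentiable_bound[where S = UNIV and f' = "deriv f"])
    show "(f has_field_derivative deriv f z) (at z within UNIV)" for z
      using assms(1)[of z] by (simp add: DERIV_deriv_iff_real_differentiable)
  qed (use assms(2) in auto)
  then show ?thesis by simp
qed

theorem theoremA3:
  fixes T A \<epsilon> :: real
    and b :: "real \<Rightarrow> real \<Rightarrow> real"
    and M :: "'w measure"
    and W :: "real \<Rightarrow> 'w \<Rightarrow> real"
    and Y :: "real \<Rightarrow> real \<Rightarrow> real \<Rightarrow> 'w \<Rightarrow> real"
  assumes "T > 0" and "A \<ge> 0" and "\<epsilon> > 0"
    and "continuous_on (UNIV \<times> {..T}) (\<lambda>(y, t). b y t)"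
    and "\<And>y t. t \<le> T \<Longrightarrow> (\<lambda>z. b z t) differentiable (at y)"
    and "continuous_on (UNIV \<times> {..T}) (\<lambda>(y, t). deriv (\<lambda>z. b z t) y)"
    and "\<And>y t. t \<le> T \<Longrightarrow> \<bar>deriv (\<lambda>z. b z t) y\<bar> \<le> A"
    and "\<And>t. t \<le> T \<Longrightarrow> concave_on UNIV (\<lambda>y. b y t)"
    and "brownian_motion M {..T} W"
    and "\<And>t y. t < T \<Longrightarrow> sde_solution M W b \<epsilon> T t y (Y t y)"
  shows "\<forall>t<T. convex_on UNIV (\<lambda>(x, y). q_fun \<epsilon> M Y T x y t)"
proof (intro allI impI)
  fix t assume "t < T"
  interpret concave_sde M W b A T t \<epsilon>
  proof
    show "\<bar>b u s - b v s\<bar> \<le> A * \<bar>u - v\<bar>" if "s \<le> T" for u v s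
      using lipschitz_of_deriv_bound[of "\<lambda>z. b z s" A u v] assms(5,7) that by blast
  qed (use assms \<open>t < T\<close> in auto)
  let ?u = "\<lambda>x y. tail_prob M Y T x y t"
  have pos: "0 < ?u x y" for x y
    unfolding tail_prob_def by (rule tail_pos[OF assms(10)[OF \<open>t < T\<close>]])
  have lc: "?u x0 y0 powr (1 - l) * ?u x1 y1 powr l \<le> ?u ((1 - l) * x0 + l * x1) ((1 - l) * y0 + l * y1)"
    if "0 < l" "l < 1" for x0 y0 x1 y1 l
    unfolding tail_prob_def by (rule tail_log_concave) (use assms(10) \<open>t < T\<close> that in auto)
  show "convex_on UNIV (\<lambda>(x, y). q_fun \<epsilon> M Y T x y t)"
  proof (rule convex_onI)
    fix l :: real and p q :: "real \<times> real" assume l: "0 < l" "l < 1"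
    obtain x0 y0 x1 y1 where pq: "p = (x0, y0)" "q = (x1, y1)" by force
    have "ln (?u x0 y0 powr (1 - l) * ?u x1 y1 powr l)
        \<le> ln (?u ((1 - l) * x0 + l * x1) ((1 - l) * y0 + l * y1))"
      using lc[OF l] pos by (intro ln_mono) (auto simp: less_imp_neq[THEN not_sym])
    moreover have "ln (?u x0 y0 powr (1 - l) * ?u x1 y1 powr l) = (1 - l) * ln (?u x0 y0) + l * ln (?u x1 y1)"
      using pos[of x0 y0] pos[of x1 y1] by (simp add: ln_mult ln_powr)
    ultimately have "\<epsilon> * ((1 - l) * ln (?u x0 y0) + l * ln (?u x1 y1))
        \<le> \<epsilon> * ln (?u ((1 - l) * x0 + l * x1) ((1 - l) * y0 + l * y1))"
      using \<open>0 < \<epsilon>\<close> by (intro mult_left_mono) auto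
    then show "(case (1 - l) *\<^sub>R p + l *\<^sub>R q of (x, y) \<Rightarrow> q_fun \<epsilon> M Y T x y t)
        \<le> (1 - l) * (case p of (x, y) \<Rightarrow> q_fun \<epsilon> M Y T x y t)
          + l * (case q of (x, y) \<Rightarrow> q_fun \<epsilon> M Y T x y t)"
      by (simp add: pq q_fun_def algebra_simps)
  qed simp
qed

end
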